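(* Let $s\in(\frac12,1)$, $N>2s$, $0<b<\min\{\frac N2,1\}$, $\beta^2=\frac{2s-b}{N}$, $a^*=\|Q\|_{2}^{2\beta^2}$, and let $V$ satisfy $0\le V\in L^\infty_{loc}(\mathbb{R}^N)$ and $\lim_{|x|\to\infty}V(x)=\infty$. For $a>0$ let $e(a)=\inf\{E_a(u): u\in\mathcal H,\ \|u\|_2^2=1\}$. Then: 1. If $0<a<a^*$, there exists at least one minimizer for $e(a)$. 2. If $a>a^*$, there is no minimizer for $e(a)$. Moreover, $e(a)>0$ for $0<a<a^*$ and $e(a)=-\infty$ for $a>a^*$.
   Context: $N$ is a positive integer (the space dimension), $\beta=\sqrt{(2s-b)/N}$, and $\|\cdot\|_2$ is the $L^2(\mathbb{R}^N)$ norm. For $u\in H^s(\mathbb{R}^N)$, $$\int_{\mathbb{R}^N}|(-\Delta)^{\frac s2}u|^2dx=\frac{C(N,s)}{2}\iint_{\mathbb{R}^{2N}}\frac{|u(x)-u(y)|^2}{|x-y|^{N+2s}}\,dx\,dy,\qquad C(N,s)=\Big(\int_{\mathbb{R}^N}\frac{1-\cos\xi_1}{|\xi|^{N+2s}}d\xi\Big)^{-1}.$$ The space is $\mathcal H=\{u\in H^s(\mathbb{R}^N):\int_{\mathbb{R}^N}V(x)|u(x)|^2dx<\infty\}$, and the energy is $$E_a(u)=\int_{\mathbb{R}^N}\big(|(-\Delta)^{\frac s2}u|^2+V(x)|u|^2\big)dx-\frac{a}{1+\beta^2}\int_{\mathbb{R}^N}\frac{|u(x)|^{2+2\beta^2}}{|x|^b}dx.$$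 A minimizer for $e(a)$ is a $u\in\mathcal H$ with $\|u\|_2^2=1$ and $E_a(u)=e(a)$. The function $Q$ and the constant $a^*$ come from the following known fractional Gagliardo–Nirenberg inequality (a recalled fact, valid for $s\in(\frac12,1)$, $N>2s$, $0<b<\min\{\frac N2,1\}$ and $\beta^2=\frac{2s-b}{N}$): $$\frac{a^*}{1+\beta^2}\int_{\mathbb{R}^N}|x|^{-b}|u(x)|^{2+2\beta^2}dx\le\|(-\Delta)^{\frac s2}u\|_2^2\,\|u\|_2^{2\beta^2}\quad\text{for all }u\in H^s(\mathbb{R}^N),$$ where the optimal constant is $a^*=\|Q\|_2^{2\beta^2}>0$; here $Q>0$ is an optimizer of this inequality (a nonzero element of $H^s(\mathbb{R}^N)$ attaining equality) that solves $(-\Delta)^sQ+Q-|x|^{-b}|Q|^{2\beta^2}Q=0$ in $\mathbb{R}^N$, and it satisfies $$\int_{\mathbb{R}^N}|(-\Delta)^{\frac s2}Q|^2dx=\frac1{\beta^2}\int_{\mathbb{R}^N}|Q|^2dx=\frac1{1+\beta^2}\int_{\mathbb{R}^N}|x|^{-b}|Q|^{2+2\beta^2}dx.$$ *)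

theory Defs
  imports "HOL-Analysis.Analysis"
begin

text \<open>
  The space \<open>\<real>\<^sup>N\<close> is a Euclidean space \<open>'a\<close> with \<open>N = DIM('a)\<close>. Functions on it are real-valued,
  and elements of \<open>L\<^sup>2\<close>, \<open>H\<^sup>s\<close> and \<open>L\<^sup>\<infinity>\<^sub>l\<^sub>o\<^sub>c\<close> are given by Borel representatives. Since
  \<open>0 powr r = 0\<close> and \<open>x / 0 = 0\<close>, the singular weights below take the value \<open>0\<close> at the
  singularity, which is a null set.
\<close>

text \<open>
  The normalising constant \<open>C(N,s)\<close>. The first coordinate \<open>\<xi>\<^sub>1\<close> is the coordinate along some element
  of the standard basis; by symmetry the integral does not depend on which one.
\<close>
definition frac_const :: "'a::euclidean_space itself \<Rightarrow> real \<Rightarrow> real" where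
  "frac_const _ s =
     inverse (LINT \<xi>|lborel.
       (1 - cos (\<xi> \<bullet> (SOME e::'a. e \<in> Basis))) / norm \<xi> powr (real DIM('a) + 2 * s))"

definition gagliardo_integrand ::
    "real \<Rightarrow> ('a::euclidean_space \<Rightarrow> real) \<Rightarrow> ('a \<Rightarrow> real) \<Rightarrow> 'a \<times> 'a \<Rightarrow> real" where
  "gagliardo_integrand s u v =
     (\<lambda>(x, y). (u x - u y) * (v x - v y) / norm (x - y) powr (real DIM('a) + 2 * s))"

definition Hs :: "real \<Rightarrow> ('a::euclidean_space \<Rightarrow> real) set" where
  "Hs s = {u \<in> borel_measurable lborel.
     integrable lborel (\<lambda>x. \<bar>u x\<bar>\<^sup>2) \<and>
     integrable (lborel \<Otimes>\<^sub>M lborel) (gagliardo_integrand s u u)}"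

text \<open>
  The bilinear form \<open>\<integral> (-\<Delta>)\<^bsup>s/2\<^esup>u (-\<Delta>)\<^bsup>s/2\<^esup>v dx\<close> on \<open>H\<^sup>s\<close>; on the diagonal it is
  \<open>\<parallel>(-\<Delta>)\<^bsup>s/2\<^esup>u\<parallel>\<^sub>2\<^sup>2\<close>.
\<close>
definition frac_form ::
    "real \<Rightarrow> ('a::euclidean_space \<Rightarrow> real) \<Rightarrow> ('a \<Rightarrow> real) \<Rightarrow> real" where
  "frac_form s u v =
     frac_const TYPE('a) s / 2 * (LINT z|(lborel \<Otimes>\<^sub>M lborel). gagliardo_integrand s u v z)"

definition frac_energy :: "real \<Rightarrow> ('a::euclidean_space \<Rightarrow> real) \<Rightarrow> real" where
  "frac_energy s u = frac_form s u u"

definition l2norm :: "('a::euclidean_space \<Rightarrow> real) \<Rightarrow> real" where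
  "l2norm u = sqrt (LINT x|lborel. \<bar>u x\<bar>\<^sup>2)"

definition nl_integrand ::
    "real \<Rightarrow> real \<Rightarrow> ('a::euclidean_space \<Rightarrow> real) \<Rightarrow> 'a \<Rightarrow> real" where
  "nl_integrand b \<beta> u x = norm x powr (- b) * \<bar>u x\<bar> powr (2 + 2 * \<beta>\<^sup>2)"

definition nl_integral ::
    "real \<Rightarrow> real \<Rightarrow> ('a::euclidean_space \<Rightarrow> real) \<Rightarrow> real" where
  "nl_integral b \<beta> u = (LINT x|lborel. nl_integrand b \<beta> u x)"

text \<open>
  The fractional Gagliardo--Nirenberg inequality with constant \<open>A\<close>. Finiteness of the left-hand side
  is part of the inequality and has to be said explicitly, as the Bochner integral of a
  non-integrable function is \<open>0\<close>.
\<close>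
definition gn_inequality ::
    "'a::euclidean_space itself \<Rightarrow> real \<Rightarrow> real \<Rightarrow> real \<Rightarrow> real \<Rightarrow> bool" where
  "gn_inequality _ s b \<beta> A \<longleftrightarrow>
     (\<forall>u \<in> (Hs s :: ('a \<Rightarrow> real) set).
        integrable lborel (nl_integrand b \<beta> u) \<and>
        A / (1 + \<beta>\<^sup>2) * nl_integral b \<beta> u \<le> frac_energy s u * l2norm u powr (2 * \<beta>\<^sup>2))"

text \<open>
  \<open>Q\<close> solves \<open>(-\<Delta>)\<^sup>sQ + Q - |x|\<^bsup>-b\<^esup>|Q|\<^bsup>2\<beta>\<^sup>2\<^esup>Q = 0\<close> weakly, with test functions in \<open>H\<^sup>s\<close>.
\<close>
definition weak_solution ::
    "real \<Rightarrow> real \<Rightarrow> real \<Rightarrow> ('a::euclidean_space \<Rightarrow> real) \<Rightarrow> bool" where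
  "weak_solution s b \<beta> Q \<longleftrightarrow> Q \<in> Hs s \<and>
     (\<forall>\<phi> \<in> Hs s.
        frac_form s Q \<phi> + (LINT x|lborel. Q x * \<phi> x)
          - (LINT x|lborel. norm x powr (- b) * \<bar>Q x\<bar> powr (2 * \<beta>\<^sup>2) * Q x * \<phi> x) = 0)"

text \<open>
  \<open>Q\<close> is a positive optimizer of the Gagliardo--Nirenberg inequality whose optimal constant is
  \<open>\<parallel>Q\<parallel>\<^sub>2\<^bsup>2\<beta>\<^sup>2\<^esup>\<close>, together with its equation and its Pohozaev-type identities.
\<close>
definition gn_optimizer ::
    "real \<Rightarrow> real \<Rightarrow> real \<Rightarrow> ('a::euclidean_space \<Rightarrow> real) \<Rightarrow> bool" where
  "gn_optimizer s b \<beta> Q \<longleftrightarrow>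
     Q \<in> Hs s \<and> (AE x in lborel. 0 < Q x) \<and>
     gn_inequality TYPE('a) s b \<beta> (l2norm Q powr (2 * \<beta>\<^sup>2)) \<and>
     l2norm Q powr (2 * \<beta>\<^sup>2) / (1 + \<beta>\<^sup>2) * nl_integral b \<beta> Q
       = frac_energy s Q * l2norm Q powr (2 * \<beta>\<^sup>2) \<and>
     weak_solution s b \<beta> Q \<and>
     frac_energy s Q = 1 / \<beta>\<^sup>2 * (LINT x|lborel. \<bar>Q x\<bar>\<^sup>2) \<and>
     frac_energy s Q = 1 / (1 + \<beta>\<^sup>2) * nl_integral b \<beta> Q"

definition Linf_loc :: "('a::euclidean_space \<Rightarrow> real) set" where
  "Linf_loc = {V \<in> borel_measurable lborel.
     \<forall>K. compact K \<longrightarrow> (\<exists>M. AE x in lborel. x \<in> K \<longrightarrow> \<bar>V x\<bar> \<le> M)}"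

definition energy_space ::
    "real \<Rightarrow> ('a::euclidean_space \<Rightarrow> real) \<Rightarrow> ('a \<Rightarrow> real) set" where
  "energy_space s V = {u \<in> Hs s. integrable lborel (\<lambda>x. V x * \<bar>u x\<bar>\<^sup>2)}"

definition energy ::
    "real \<Rightarrow> real \<Rightarrow> real \<Rightarrow> ('a::euclidean_space \<Rightarrow> real) \<Rightarrow> real \<Rightarrow> ('a \<Rightarrow> real) \<Rightarrow> real" where
  "energy s b \<beta> V a u =
     frac_energy s u + (LINT x|lborel. V x * \<bar>u x\<bar>\<^sup>2)
       - a / (1 + \<beta>\<^sup>2) * nl_integral b \<beta> u"

definition admissible ::
    "real \<Rightarrow> ('a::euclidean_space \<Rightarrow> real) \<Rightarrow> ('a \<Rightarrow> real) set" where
  "admissible s V = {u \<in> energy_space s V. (l2norm u)\<^sup>2 = 1}"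

definition min_energy ::
    "real \<Rightarrow> real \<Rightarrow> real \<Rightarrow> ('a::euclidean_space \<Rightarrow> real) \<Rightarrow> real \<Rightarrow> ereal" where
  "min_energy s b \<beta> V a = (INF u \<in> admissible s V. ereal (energy s b \<beta> V a u))"

definition is_minimizer ::
    "real \<Rightarrow> real \<Rightarrow> real \<Rightarrow> ('a::euclidean_space \<Rightarrow> real) \<Rightarrow> real \<Rightarrow> ('a \<Rightarrow> real) \<Rightarrow> bool" where
  "is_minimizer s b \<beta> V a u \<longleftrightarrow>
     u \<in> admissible s V \<and> ereal (energy s b \<beta> V a u) = min_energy s b \<beta> V a"

end

theory Submission
  imports Defs "HOL-Complex_Analysis.Great_Picard" "HOL-Real_Asymp.Real_Asymp"
begin

text \<open>
  For \<open>a > a\<^sup>*\<close> the function \<open>Q\<close> strictly violates the Gagliardo--Nirenberg inequality with constant \<open>a\<close>,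
  and so does \<open>Q\<close> times a Lipschitz cutoff. The kinetic and the nonlinear term both scale like
  \<open>\<tau>\<^bsup>2s\<^esup>\<close> under \<open>w \<mapsto> \<tau>\<^bsup>N/2\<^esup>w(\<tau>\<cdot>)\<close>, whereas the potential term of a compactly supported function stays
  bounded as \<open>\<tau> \<longrightarrow> \<infinity>\<close>; hence the energy is unbounded below. No decay of \<open>Q\<close> is needed.

  For \<open>a < a\<^sup>*\<close> the inequality bounds the Gagliardo seminorms and the potential terms of a minimizing sequence.
  Averaging over the cells of a grid of width \<open>h\<close> changes a function by at most \<open>C h\<^sup>s\<close> times its seminorm in
  \<open>L\<^sup>2\<close>, and there are only countably many cells, so a diagonal subsequence has convergent averages; the
  growth of \<open>V\<close> controls the tails. This gives strong \<open>L\<^sup>2\<close> convergence. Fatou's lemma handles the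
  quadratic terms, and the Gagliardo--Nirenberg inequality applied to \<open>u\<^sub>n - u\<close> handles the nonlinear one.
\<close>

subsection \<open>Integration\<close>

text \<open>Passing through the nonnegative integral makes integrability of the limit a conclusion
  instead of a prerequisite. The bound is only eventual, so it can be used for the tail of a Cauchy
  sequence.\<close>

lemma fatou_integral_le:
  fixes f :: "nat \<Rightarrow> 'a \<Rightarrow> real"
  assumes int: "\<And>n. integrable M (f n)"
    and nonneg: "\<And>n. AE x in M. 0 \<le> f n x"
    and meas [measurable]: "g \<in> borel_measurable M"
    and lim: "AE x in M. (\<lambda>n. f n x) \<longlonglongrightarrow> g x"
    and bound: "eventually (\<lambda>n. (LINT x|M. f n x) \<le> C) sequentially"
  shows "integrable M g" "(LINT x|M. g x) \<le> C"
proof -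
  have fm [measurable]: "f n \<in> borel_measurable M" for n
    using int by auto
  have all: "AE x in M. \<forall>n. 0 \<le> f n x"
    using nonneg by (simp add: AE_all_countable)
  have g0: "AE x in M. 0 \<le> g x"
    using all lim by eventually_elim (auto intro: LIMSEQ_le_const)
  have C: "0 \<le> C"
  proof -
    obtain n where "(LINT x|M. f n x) \<le> C"
      using bound by (auto simp: eventually_sequentially)
    moreover have "0 \<le> (LINT x|M. f n x)" by (intro integral_nonneg_AE nonneg)
    ultimately show ?thesis by linarith
  qed
  have "(\<integral>\<^sup>+x. ennreal (g x) \<partial>M) = (\<integral>\<^sup>+x. liminf (\<lambda>n. ennreal (f n x)) \<partial>M)"
    using lim by (intro nn_integral_cong_AE, eventually_elim)
      (intro lim_imp_Liminf[symmetric] tendsto_ennrealI, auto)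
  also have "\<dots> \<le> liminf (\<lambda>n. \<integral>\<^sup>+x. ennreal (f n x) \<partial>M)"
    by (intro nn_integral_liminf) auto
  also have "\<dots> = liminf (\<lambda>n. ennreal (LINT x|M. f n x))"
    by (simp add: nn_integral_eq_integral[OF int nonneg])
  also have "\<dots> \<le> ennreal C"
    using bound by (intro Liminf_le eventually_mono[OF bound] ennreal_leI) auto
  finally have le: "(\<integral>\<^sup>+x. ennreal (g x) \<partial>M) \<le> ennreal C" .
  show i: "integrable M g"
    by (rule integrableI_nonneg) (use le g0 in \<open>auto simp: le_less_trans\<close>)
  have "ennreal (LINT x|M. g x) \<le> ennreal C"
    using le by (simp add: nn_integral_eq_integral[OF i g0])
  then show "(LINT x|M. g x) \<le> C" using C by (simp add: ennreal_le_iff)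
qed

lemma fatou_integral_tendsto:
  fixes f :: "nat \<Rightarrow> 'a \<Rightarrow> real"
  assumes "\<And>n. integrable M (f n)" "\<And>n. AE x in M. 0 \<le> f n x"
    "g \<in> borel_measurable M" "AE x in M. (\<lambda>n. f n x) \<longlonglongrightarrow> g x"
    and conv: "(\<lambda>n. LINT x|M. f n x) \<longlonglongrightarrow> l"
  shows "integrable M g" "(LINT x|M. g x) \<le> l"
proof -
  have ev: "eventually (\<lambda>n. (LINT x|M. f n x) \<le> l + e) sequentially" if "e > 0" for e
    using order_tendstoD(2)[OF conv, of "l + e"] that by (auto elim: eventually_mono)
  show "integrable M g" using fatou_integral_le(1)[OF assms(1-4) ev[of 1]] by simp
  show "(LINT x|M. g x) \<le> l"
    by (rule field_le_epsilon) (rule fatou_integral_le(2)[OF assms(1-4) ev])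
qed

section \<open>Changes of variables and product measures\<close>

text \<open>\<open>lborel\<close> is a push-forward of itself with density
  \<open>\<bar>c\<bar> ^ DIM('a)\<close>. Negative \<open>c\<close> is included: reflections are
  used for convolution kernels, dilations for the scaling laws.\<close>

lemma
  fixes f :: "'a::euclidean_space \<Rightarrow> real"
  assumes [measurable]: "f \<in> borel_measurable borel" and c: "c \<noteq> 0"
  shows integrable_lborel_affine_iff:
      "integrable lborel (\<lambda>x. f (t + c *\<^sub>R x)) \<longleftrightarrow> integrable lborel f"
    and integral_lborel_affine:
      "(LINT x|lborel. f (t + c *\<^sub>R x)) = (LINT x|lborel. f x) / \<bar>c\<bar> ^ DIM('a)"
proof -
  have "integrable lborel f \<longleftrightarrow>
      integrable (density (distr lborel borel (\<lambda>x. t + c *\<^sub>R x)) (\<lambda>_. \<bar>c\<bar> ^ DIM('a))) f"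
    using lborel_affine[OF c, of t] by simp
  also have "\<dots> \<longleftrightarrow> integrable lborel (\<lambda>x. f (t + c *\<^sub>R x))"
    using c by (subst integrable_density) (auto simp: integrable_distr_eq)
  finally show "integrable lborel (\<lambda>x. f (t + c *\<^sub>R x)) \<longleftrightarrow> integrable lborel f" by simp
  have "(LINT x|lborel. f x) =
      (LINT x|(density (distr lborel borel (\<lambda>x. t + c *\<^sub>R x)) (\<lambda>_. \<bar>c\<bar> ^ DIM('a))). f x)"
    using lborel_affine[OF c, of t] by simp
  also have "\<dots> = \<bar>c\<bar> ^ DIM('a) * (LINT x|lborel. f (t + c *\<^sub>R x))"
    using c by (subst integral_density) (auto simp: integral_distr)
  finally show "(LINT x|lborel. f (t + c *\<^sub>R x)) = (LINT x|lborel. f x) / \<bar>c\<bar> ^ DIM('a)"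
    using c by simp
qed

lemmas integrable_lborel_scaleR_iff = integrable_lborel_affine_iff[where t = 0, simplified]
lemmas integral_lborel_scaleR = integral_lborel_affine[where t = 0, simplified]

text \<open>Tonelli: by translation and reflection, the inner integral of
  \<open>\<bar>g (x - y)\<bar>\<close> over \<open>y\<close> is the same number for every
  \<open>x\<close>.\<close>

lemma integrable_mult_convolution_kernel:
  fixes f g :: "'a::euclidean_space \<Rightarrow> real"
  assumes f: "integrable lborel f" and g: "integrable lborel g"
  shows "integrable (lborel \<Otimes>\<^sub>M lborel) (\<lambda>z. f (fst z) * g (fst z - snd z))"
proof -
  have [measurable]: "f \<in> borel_measurable borel" "g \<in> borel_measurable borel"
    using f g by auto
  have int: "integrable lborel (\<lambda>y. g (x - y))" for x
    using integrable_lborel_affine_iff[of g "- 1" x] g by simp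
  have eq: "(LINT y|lborel. \<bar>g (x - y)\<bar>) = (LINT y|lborel. \<bar>g y\<bar>)" for x
    using integral_lborel_affine[of "\<lambda>x. \<bar>g x\<bar>" "- 1" x] by simp
  have "integrable (lborel \<Otimes>\<^sub>M lborel) (\<lambda>(x, y). f x * g (x - y))"
  proof (rule lborel_pair.Fubini_integrable)
    show "integrable lborel (\<lambda>x. LINT y|lborel. norm (case (x, y) of (x, y) \<Rightarrow> f x * g (x - y)))"
      using f by (simp add: abs_mult eq)
    show "AE x in lborel. integrable lborel (\<lambda>y. case (x, y) of (x, y) \<Rightarrow> f x * g (x - y))"
      using int by simp
  qed measurable
  then show ?thesis by (simp add: case_prod_beta')
qed

text \<open>The cylinder over a null set is null, even over a space of infinite measure. This and
  its mirror image carry almost-everywhere convergence of functions over to their Gagliardo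
  integrands.\<close>

lemma AE_pair_fst:
  assumes "AE x in M. P x" and "sigma_finite_measure N"
  shows "AE z in M \<Otimes>\<^sub>M N. P (fst z)"
proof -
  interpret N: sigma_finite_measure N by fact
  from assms(1) obtain A where A: "{x \<in> space M. \<not> P x} \<subseteq> A" "A \<in> null_sets M"
    by (auto simp: eventually_ae_filter)
  have "A \<times> space N \<in> null_sets (M \<Otimes>\<^sub>M N)"
    using null_setsD1[OF A(2)] null_setsD2[OF A(2)]
    by (intro null_setsI) (auto simp: N.emeasure_pair_measure_Times)
  then show ?thesis
    by (rule AE_I') (use A in \<open>auto simp: space_pair_measure\<close>)
qed

lemma AE_pair_snd:
  assumes "AE y in N. P y" and "sigma_finite_measure N"
  shows "AE z in M \<Otimes>\<^sub>M N. P (snd z)"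
proof -
  interpret N: sigma_finite_measure N by fact
  from assms(1) obtain A where A: "{x \<in> space N. \<not> P x} \<subseteq> A" "A \<in> null_sets N"
    by (auto simp: eventually_ae_filter)
  have "space M \<times> A \<in> null_sets (M \<Otimes>\<^sub>M N)"
    using null_setsD1[OF A(2)] null_setsD2[OF A(2)]
    by (intro null_setsI) (auto simp: N.emeasure_pair_measure_Times)
  then show ?thesis
    by (rule AE_I') (use A in \<open>auto simp: space_pair_measure\<close>)
qed

section \<open>Integrability of the truncated singular kernel\<close>

lemma ex_dyadic_interval:
  fixes x :: real
  assumes "1 \<le> x"
  obtains k :: nat where "2 ^ k \<le> x" "x < 2 ^ Suc k"
proof
  define k where "k = nat \<lfloor>log 2 x\<rfloor>"
  have k: "real k \<le> log 2 x" "log 2 x < real (Suc k)"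
    using assms by (auto simp: k_def zero_le_log_cancel_iff) linarith+
  show "2 ^ k \<le> x" "x < 2 ^ Suc k"
    using k assms by (auto simp: le_log_iff log_less_iff powr_realpow simp del: power_Suc of_nat_Suc)
qed

text \<open>Bounding by a sum of constants times indicators of dyadic balls replaces polar coordinates.\<close>

lemma integrable_min_norm_power2_div_powr:
  fixes p :: real
  assumes p: "real DIM('a::euclidean_space) < p" "p < real DIM('a) + 2"
  shows "integrable lborel (\<lambda>z::'a. min 1 ((norm z)\<^sup>2) / norm z powr p)"
proof (rule integrableI_nonneg)
  let ?f = "\<lambda>z::'a. min 1 ((norm z)\<^sup>2) / norm z powr p"
  let ?N = "real DIM('a)"
  define \<omega> where "\<omega> = unit_ball_vol ?N"
  have \<omega>: "0 \<le> \<omega>" by (simp add: \<omega>_def)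
  \<comment> \<open>\<open>A k\<close> bounds the kernel on the shell between the radii
    \<open>1 / 2 ^ Suc k\<close> and \<open>1 / 2 ^ k\<close>, where the numerator is at most
    \<open>(1 / 2 ^ k)^2\<close>; \<open>B k\<close> bounds it between \<open>2 ^ k\<close> and
    \<open>2 ^ Suc k\<close>, where the numerator is 1.\<close>
  define A where "A k = 2 powr p * (2 powr (p - 2)) ^ k" for k :: nat
  define B where "B k = (2 powr (- p)) ^ k" for k :: nat
  have AB: "0 \<le> A k" "0 \<le> B k" for k by (simp_all add: A_def B_def)
  have le_suminf: "f k \<le> (\<Sum>k. f k)" for f :: "nat \<Rightarrow> ennreal" and k
    using sum_le_suminf[of f "{k}"] by simp
  have bound: "ennreal (?f z) \<le>
      (\<Sum>k. ennreal (A k) * indicator (cball 0 (1 / 2 ^ k)) z) +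
      (\<Sum>k. ennreal (B k) * indicator (cball 0 (2 ^ Suc k)) z)" (is "_ \<le> ?S1 + ?S2") for z
  proof (cases "z = 0")
    case False
    then have z: "0 < norm z" by simp
    show ?thesis
    proof (cases "1 \<le> norm z")
      case True
      then obtain k where k: "2 ^ k \<le> norm z" "norm z < 2 ^ Suc k"
        by (rule ex_dyadic_interval)
      have "(2 powr real k) powr p \<le> norm z powr p"
        using k p by (intro powr_mono2) (auto simp: powr_realpow)
      then have "?f z \<le> 1 / (2 powr real k) powr p"
        by (intro frac_le) auto
      also have "\<dots> = B k"
        unfolding B_def by (subst powr_realpow[symmetric])
          (simp_all add: powr_powr powr_minus_divide[symmetric] mult.commute)
      finally have "ennreal (?f z) \<le> ennreal (B k) * indicator (cball 0 (2 ^ Suc k)) z"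
        using k by (auto simp: indicator_def ennreal_leI)
      also have "\<dots> \<le> ?S2"
        by (rule le_suminf[where f = "\<lambda>k. ennreal (B k) * indicator (cball 0 (2 ^ Suc k)) z"])
      finally show ?thesis by (simp add: add_increasing)
    next
      case False
      then have "1 \<le> 1 / norm z" using z by simp
      then obtain k where k: "2 ^ k \<le> 1 / norm z" "1 / norm z < 2 ^ Suc k"
        by (rule ex_dyadic_interval)
      then have k': "norm z \<le> 1 / 2 ^ k" "1 / 2 ^ Suc k \<le> norm z"
        using z by (auto simp: field_simps)
      have "(1 / 2 ^ Suc k) powr p \<le> norm z powr p"
        using k' p by (intro powr_mono2) auto
      moreover have "(norm z)\<^sup>2 \<le> (1 / 2 ^ k)\<^sup>2"
        using k' by (intro power_mono) auto
      then have "min 1 ((norm z)\<^sup>2) \<le> (1 / 2 ^ k)\<^sup>2" by linarith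
      ultimately have "?f z \<le> (1 / 2 ^ k)\<^sup>2 / (1 / 2 ^ Suc k) powr p"
        by (intro frac_le) auto
      also have "\<dots> = A k"
      proof -
        have e: "1 / 2 ^ n = 2 powr (- real n)" for n :: nat
          by (simp add: powr_minus powr_realpow inverse_eq_divide)
        have "(1 / 2 ^ k)\<^sup>2 = 2 powr (- 2 * real k)"
          unfolding e by (simp add: power2_eq_square flip: powr_add)
        moreover have "(1 / 2 ^ Suc k) powr p = 2 powr (- real (Suc k) * p)"
          unfolding e by (simp add: powr_powr)
        moreover have "A k = 2 powr (p + (p - 2) * real k)"
          by (simp add: A_def powr_add powr_powr flip: powr_realpow)
        ultimately show ?thesis
          by (simp add: algebra_simps flip: powr_diff)
      qed
      finally have "ennreal (?f z) \<le> ennreal (A k) * indicator (cball 0 (1 / 2 ^ k)) z"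
        using k' by (auto simp: indicator_def ennreal_leI)
      also have "\<dots> \<le> ?S1"
        by (rule le_suminf[where f = "\<lambda>k. ennreal (A k) * indicator (cball 0 (1 / 2 ^ k)) z"])
      finally show ?thesis by (simp add: add_increasing2)
    qed
  qed auto
  have fin: "(\<Sum>k. ennreal (c * r ^ k)) < \<infinity>" if "0 \<le> c" "0 \<le> r" "r < 1" for c r :: real
    using that by (subst suminf_ennreal2) (auto intro!: summable_mult summable_geometric)
  have "(\<integral>\<^sup>+z. ennreal (?f z) \<partial>lborel) \<le> (\<integral>\<^sup>+z.
      (\<Sum>k. ennreal (A k) * indicator (cball 0 (1 / 2 ^ k)) z) +
      (\<Sum>k. ennreal (B k) * indicator (cball 0 (2 ^ Suc k)) z) \<partial>(lborel::'a measure))"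
    by (intro nn_integral_mono bound)
  also have "\<dots> = (\<Sum>k. ennreal (A k) * ennreal (\<omega> * (1 / 2 ^ k) ^ DIM('a))) +
      (\<Sum>k. ennreal (B k) * ennreal (\<omega> * (2 ^ Suc k) ^ DIM('a)))"
  proof -
    have ball: "(\<integral>\<^sup>+z. c * indicator (cball 0 r) z \<partial>(lborel::'a measure)) =
        c * ennreal (\<omega> * r ^ DIM('a))" if "0 \<le> r" for c r
      using nn_integral_cmult_indicator[of "cball 0 r" "lborel::'a measure" c] that
      by (simp add: emeasure_cball \<omega>_def)
    have m: "(\<lambda>z::'a. c * indicator (cball 0 r) z) \<in> borel_measurable lborel" for c :: ennreal and r
      by (intro borel_measurable_times_ennreal borel_measurable_indicator) (auto simp: borel_closed)
    have 1: "(\<integral>\<^sup>+z. (\<Sum>k. ennreal (A k) * indicator (cball 0 (1 / 2 ^ k)) z) \<partial>(lborel::'a measure)) =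
        (\<Sum>k. ennreal (A k) * ennreal (\<omega> * (1 / 2 ^ k) ^ DIM('a)))"
      by (subst nn_integral_suminf[OF m], simp only: ball zero_le_power zero_le_divide_1_iff zero_le_numeral)
    have 2: "(\<integral>\<^sup>+z. (\<Sum>k. ennreal (B k) * indicator (cball 0 (2 ^ Suc k)) z) \<partial>(lborel::'a measure)) =
        (\<Sum>k. ennreal (B k) * ennreal (\<omega> * (2 ^ Suc k) ^ DIM('a)))"
      by (subst nn_integral_suminf[OF m], simp only: ball zero_le_power zero_le_numeral)
    show ?thesis
      unfolding 1[symmetric] 2[symmetric]
      by (rule nn_integral_add) (rule borel_measurable_suminf_order m)+
  qed
  \<comment> \<open>With the ball volumes included, both series are geometric. The two bounds on
    \<open>p\<close> say exactly that their ratios are below 1.\<close>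
  also have "\<dots> = (\<Sum>k. ennreal ((\<omega> * 2 powr p) * (2 powr (p - 2 - ?N)) ^ k)) +
      (\<Sum>k. ennreal ((\<omega> * 2 powr ?N) * (2 powr (?N - p)) ^ k))"
  proof -
    have 1: "A k * (\<omega> * (1 / 2 ^ k) ^ DIM('a)) = (\<omega> * 2 powr p) * (2 powr (p - 2 - ?N)) ^ k" for k
    proof -
      have "(1 / 2 ^ k) ^ DIM('a) = (2 powr (- ?N)) ^ k"
        by (simp add: powr_minus powr_realpow power_divide inverse_eq_divide)
          (metis mult.commute power_mult)
      moreover have "2 powr (p - 2 - ?N) = 2 powr (p - 2) * 2 powr (- ?N)"
        by (simp flip: powr_add)
      ultimately show ?thesis by (simp add: A_def power_mult_distrib)
    qed
    have 2: "B k * (\<omega> * (2 ^ Suc k) ^ DIM('a)) = (\<omega> * 2 powr ?N) * (2 powr (?N - p)) ^ k" for k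
    proof -
      have "(2 ^ Suc k) ^ DIM('a) = 2 powr ?N * (2 powr ?N) ^ k"
        by (simp add: powr_realpow power_mult_distrib) (metis mult.commute power_mult)
      moreover have "2 powr (?N - p) = 2 powr ?N * 2 powr (- p)"
        by (simp flip: powr_add)
      ultimately show ?thesis by (simp add: B_def power_mult_distrib)
    qed
    show ?thesis
      using \<omega> by (simp only: AB ennreal_mult[symmetric] mult_nonneg_nonneg zero_le_power
          zero_le_divide_1_iff zero_le_numeral 1 2)
  qed
  also have "\<dots> < \<infinity>"
  proof -
    have "2 powr x < (1::real)" if "x < 0" for x
      using powr_less_mono[OF that, of 2] by simp
    then have "(\<Sum>k. ennreal ((\<omega> * 2 powr p) * (2 powr (p - 2 - ?N)) ^ k)) < \<infinity>"
      "(\<Sum>k. ennreal ((\<omega> * 2 powr ?N) * (2 powr (?N - p)) ^ k)) < \<infinity>"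
      using p \<omega> by (auto intro!: fin simp del: infinity_ennreal_def)
    then show ?thesis
      by (simp only: infinity_ennreal_def ennreal_add_less_top)
  qed
  finally show "(\<integral>\<^sup>+z. ennreal (?f z) \<partial>lborel) < \<infinity>" .
qed auto

subsection \<open>The Gagliardo seminorm\<close>

text \<open>The squared seminorm without the factor \<open>frac_const / 2\<close>. Estimates on it
  do not depend on the sign of that constant, which is settled only in the final theorem.\<close>

definition gagliardo :: "real \<Rightarrow> ('a::euclidean_space \<Rightarrow> real) \<Rightarrow> real" where
  "gagliardo s u = (LINT z|(lborel \<Otimes>\<^sub>M lborel). gagliardo_integrand s u u z)"

lemma frac_energy_gagliardo:
  fixes u :: "'a::euclidean_space \<Rightarrow> real"
  shows "frac_energy s u = frac_const TYPE('a) s / 2 * gagliardo s u"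
  by (simp add: frac_energy_def frac_form_def gagliardo_def)

lemma borel_measurable_gagliardo_integrand [measurable]:
  fixes u v :: "'a::euclidean_space \<Rightarrow> real"
  assumes [measurable]: "u \<in> borel_measurable borel" "v \<in> borel_measurable borel"
  shows "gagliardo_integrand s u v \<in> borel_measurable (lborel \<Otimes>\<^sub>M lborel)"
  unfolding gagliardo_integrand_def by measurable

lemma gagliardo_integrand_diag:
  fixes u :: "'a::euclidean_space \<Rightarrow> real"
  shows "gagliardo_integrand s u u z =
    (u (fst z) - u (snd z))\<^sup>2 / norm (fst z - snd z) powr (real DIM('a) + 2 * s)"
  by (simp add: gagliardo_integrand_def case_prod_beta power2_eq_square)

lemma gagliardo_integrand_nonneg: "0 \<le> gagliardo_integrand s u u z"
  by (simp add: gagliardo_integrand_diag)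

lemma gagliardo_nonneg: "0 \<le> gagliardo s u"
  by (simp add: gagliardo_def gagliardo_integrand_nonneg)

lemma HsD:
  assumes "u \<in> Hs s"
  shows "u \<in> borel_measurable borel" "integrable lborel (\<lambda>x. (u x)\<^sup>2)"
    "integrable (lborel \<Otimes>\<^sub>M lborel) (gagliardo_integrand s u u)"
  using assms by (auto simp: Hs_def)

lemma HsI:
  assumes "u \<in> borel_measurable borel" "integrable lborel (\<lambda>x. (u x)\<^sup>2)"
    "integrable (lborel \<Otimes>\<^sub>M lborel) (gagliardo_integrand s u u)"
  shows "u \<in> Hs s"
  using assms by (auto simp: Hs_def)

lemma l2norm_power2: "(l2norm u)\<^sup>2 = (LINT x|lborel. (u x)\<^sup>2)"
  by (simp add: l2norm_def)

lemma l2norm_nonneg: "0 \<le> l2norm u"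
  by (simp add: l2norm_def)

lemma diff_power2_le: "(a - b)\<^sup>2 \<le> 2 * a\<^sup>2 + 2 * (b::real)\<^sup>2"
  using zero_le_power2[of "a + b"] by (simp add: power2_eq_square algebra_simps)

lemma integrable_diff_power2:
  fixes f g :: "'a \<Rightarrow> real"
  assumes [measurable]: "f \<in> borel_measurable M" "g \<in> borel_measurable M"
    and i: "integrable M (\<lambda>x. (f x)\<^sup>2)" "integrable M (\<lambda>x. (g x)\<^sup>2)"
  shows "integrable M (\<lambda>x. (f x - g x)\<^sup>2)"
proof (rule Bochner_Integration.integrable_bound)
  show "integrable M (\<lambda>x. 2 * (f x)\<^sup>2 + 2 * (g x)\<^sup>2)"
    using i by auto
qed (use diff_power2_le in auto)

lemma gagliardo_integrand_diff_le:
  "gagliardo_integrand s (\<lambda>x. u x - v x) (\<lambda>x. u x - v x) z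
    \<le> 2 * gagliardo_integrand s u u z + 2 * gagliardo_integrand s v v z"
proof -
  have "(u (fst z) - v (fst z) - (u (snd z) - v (snd z)))\<^sup>2
    \<le> 2 * (u (fst z) - u (snd z))\<^sup>2 + 2 * (v (fst z) - v (snd z))\<^sup>2"
    using diff_power2_le[of "u (fst z) - u (snd z)" "v (fst z) - v (snd z)"]
    by (simp add: algebra_simps)
  then show ?thesis
    unfolding gagliardo_integrand_diag times_divide_eq_right add_divide_distrib[symmetric]
    by (intro divide_right_mono) auto
qed

text \<open>Crude constants suffice: differences occur only where a uniform bound is wanted, namely
  between members of a bounded sequence and between such members and their limit.\<close>

lemma Hs_diff:
  fixes u v :: "'a::euclidean_space \<Rightarrow> real"
  assumes u: "u \<in> Hs s" and v: "v \<in> Hs s"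
  shows "(\<lambda>x. u x - v x) \<in> Hs s"
    and "gagliardo s (\<lambda>x. u x - v x) \<le> 2 * gagliardo s u + 2 * gagliardo s v"
proof -
  note [measurable] = HsD(1)[OF u] HsD(1)[OF v]
  have i: "integrable (lborel \<Otimes>\<^sub>M lborel)
      (\<lambda>z. 2 * gagliardo_integrand s u u z + 2 * gagliardo_integrand s v v z)"
    using HsD(3)[OF u] HsD(3)[OF v] by auto
  have j: "integrable (lborel \<Otimes>\<^sub>M lborel)
      (gagliardo_integrand s (\<lambda>x. u x - v x) (\<lambda>x. u x - v x))"
    using i
  proof (rule Bochner_Integration.integrable_bound)
    show "AE z in lborel \<Otimes>\<^sub>M lborel.
        norm (gagliardo_integrand s (\<lambda>x. u x - v x) (\<lambda>x. u x - v x) z)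
        \<le> norm (2 * gagliardo_integrand s u u z + 2 * gagliardo_integrand s v v z)"
    proof (intro AE_I2)
      fix z
      show "norm (gagliardo_integrand s (\<lambda>x. u x - v x) (\<lambda>x. u x - v x) z)
        \<le> norm (2 * gagliardo_integrand s u u z + 2 * gagliardo_integrand s v v z)"
        using gagliardo_integrand_diff_le[of s u v z]
          gagliardo_integrand_nonneg[of s "\<lambda>x. u x - v x" z] by simp
    qed
  qed measurable
  show "(\<lambda>x. u x - v x) \<in> Hs s"
    using HsD(2)[OF u] HsD(2)[OF v] j by (intro HsI integrable_diff_power2) auto
  have "gagliardo s (\<lambda>x. u x - v x)
      \<le> (LINT z|(lborel \<Otimes>\<^sub>M lborel). 2 * gagliardo_integrand s u u z + 2 * gagliardo_integrand s v v z)"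
    unfolding gagliardo_def by (intro integral_mono i j gagliardo_integrand_diff_le)
  also have "\<dots> = 2 * gagliardo s u + 2 * gagliardo s v"
    using HsD(3)[OF u] HsD(3)[OF v] by (simp add: gagliardo_def)
  finally show "gagliardo s (\<lambda>x. u x - v x) \<le> 2 * gagliardo s u + 2 * gagliardo s v" .
qed

section \<open>Behaviour under dilations\<close>

lemma gagliardo_integrand_scale:
  fixes w :: "'a::euclidean_space \<Rightarrow> real"
  assumes "0 < \<tau>"
  shows "gagliardo_integrand s (\<lambda>x. k * w (\<tau> *\<^sub>R x)) (\<lambda>x. k * w (\<tau> *\<^sub>R x)) z =
    k\<^sup>2 * \<tau> powr (real DIM('a) + 2 * s) * gagliardo_integrand s w w (\<tau> *\<^sub>R z)"
proof -
  have "norm (\<tau> *\<^sub>R fst z - \<tau> *\<^sub>R snd z) = \<tau> * norm (fst z - snd z)"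
    using assms by (simp flip: scaleR_diff_right)
  then show ?thesis
    using assms
    by (simp add: gagliardo_integrand_diag powr_mult power_mult_distrib flip: right_diff_distrib)
qed

text \<open>Each identity is one change of variables. For the double integral,
  \<open>lborel_prod\<close> turns the product measure into Lebesgue measure on
  \<open>'a \<times> 'a\<close>, so the Jacobian there has exponent
  \<open>2 * DIM('a)\<close>.\<close>

lemma Hs_scale:
  fixes w :: "'a::euclidean_space \<Rightarrow> real" and s k b \<beta> \<tau> :: real
  assumes w: "w \<in> Hs s" and \<tau>: "0 < \<tau>"
  defines "u \<equiv> (\<lambda>x. k * w (\<tau> *\<^sub>R x))"
  shows "u \<in> Hs s"
    and "gagliardo s u = k\<^sup>2 * \<tau> powr (2 * s - DIM('a)) * gagliardo s w"
    and "(l2norm u)\<^sup>2 = k\<^sup>2 * \<tau> powr (- DIM('a)) * (l2norm w)\<^sup>2"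
    and "nl_integral b \<beta> u
        = \<bar>k\<bar> powr (2 + 2 * \<beta>\<^sup>2) * \<tau> powr (b - DIM('a)) * nl_integral b \<beta> w"
proof -
  note [measurable] = HsD(1)[OF w]
  have [measurable]: "gagliardo_integrand s w w \<in> borel_measurable borel"
    using borel_measurable_gagliardo_integrand[OF HsD(1)[OF w] HsD(1)[OF w]]
    by (simp add: lborel_prod)
  have pw: "\<bar>\<tau>\<bar> ^ n = \<tau> powr n" for n
    using \<tau> by (simp add: powr_realpow)
  have um [measurable]: "u \<in> borel_measurable borel"
    unfolding u_def by measurable
  have g: "gagliardo_integrand s u u =
      (\<lambda>z. k\<^sup>2 * \<tau> powr (real DIM('a) + 2 * s) * gagliardo_integrand s w w (\<tau> *\<^sub>R z))"
    unfolding u_def by (rule ext gagliardo_integrand_scale \<tau>)+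
  have ig: "integrable lborel (\<lambda>z. gagliardo_integrand s w w (\<tau> *\<^sub>R z))"
    using HsD(3)[OF w] \<tau> by (subst integrable_lborel_scaleR_iff) (auto simp: lborel_prod)
  have i2: "integrable lborel (\<lambda>x. (w (\<tau> *\<^sub>R x))\<^sup>2)"
    using HsD(2)[OF w] \<tau> by (subst integrable_lborel_scaleR_iff[of "\<lambda>x. (w x)\<^sup>2"]) auto
  show "u \<in> Hs s"
    using ig i2 by (intro HsI um) (auto simp: g lborel_prod, auto simp: u_def power_mult_distrib)
  have "gagliardo s u = k\<^sup>2 * \<tau> powr (real DIM('a) + 2 * s) *
      (gagliardo s w / \<tau> powr (real (DIM('a) + DIM('a))))"
    using \<tau> unfolding gagliardo_def g lborel_prod
    by (simp add: integral_lborel_scaleR powr_realpow del: of_nat_add)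
  also have "\<dots> = k\<^sup>2 * \<tau> powr (2 * s - DIM('a)) * gagliardo s w"
    using \<tau> powr_add[of \<tau> "DIM('a)" "DIM('a)"] by (simp add: powr_add powr_diff)
  finally show "gagliardo s u = k\<^sup>2 * \<tau> powr (2 * s - DIM('a)) * gagliardo s w" .
  have "(l2norm u)\<^sup>2 = k\<^sup>2 * ((l2norm w)\<^sup>2 / \<tau> powr DIM('a))"
    using \<tau> integral_lborel_scaleR[of "\<lambda>x. (w x)\<^sup>2" \<tau>]
    by (simp add: l2norm_power2 u_def power_mult_distrib powr_realpow)
  then show "(l2norm u)\<^sup>2 = k\<^sup>2 * \<tau> powr (- DIM('a)) * (l2norm w)\<^sup>2"
    using \<tau> by (simp add: powr_minus field_simps)
  have nl: "nl_integrand b \<beta> u x =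
      \<bar>k\<bar> powr (2 + 2 * \<beta>\<^sup>2) * \<tau> powr b * nl_integrand b \<beta> w (\<tau> *\<^sub>R x)" for x
    using \<tau> by (simp add: nl_integrand_def u_def abs_mult powr_mult powr_minus)
  have "nl_integral b \<beta> u = \<bar>k\<bar> powr (2 + 2 * \<beta>\<^sup>2) * \<tau> powr b * (nl_integral b \<beta> w / \<tau> powr DIM('a))"
    using \<tau> integral_lborel_scaleR[of "nl_integrand b \<beta> w" \<tau>]
    unfolding nl_integral_def nl by (simp add: powr_realpow nl_integrand_def[abs_def])
  then show "nl_integral b \<beta> u
        = \<bar>k\<bar> powr (2 + 2 * \<beta>\<^sup>2) * \<tau> powr (b - DIM('a)) * nl_integral b \<beta> w"
    by (simp add: powr_diff)
qed

subsection \<open>Cutoff, concentration and energies unbounded below\<close>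

text \<open>Piecewise linear in \<open>norm x\<close>: equal to 1 up to radius \<open>Suc n\<close>,
  to 0 beyond twice that radius. \<open>Suc\<close> keeps the radius positive and the Lipschitz
  constant at most 1.\<close>

definition cutoff :: "nat \<Rightarrow> 'a::euclidean_space \<Rightarrow> real" where
  "cutoff n x = max 0 (min 1 (2 - norm x / real (Suc n)))"

lemma borel_measurable_cutoff [measurable]: "cutoff n \<in> borel_measurable borel"
  unfolding cutoff_def by measurable

lemma cutoff_nonneg: "0 \<le> cutoff n x" and cutoff_le_1: "cutoff n x \<le> 1"
  by (auto simp: cutoff_def)

lemma cutoff_eq_0: "2 * real (Suc n) \<le> norm x \<Longrightarrow> cutoff n x = 0"
  by (auto simp: cutoff_def field_simps)

text \<open>The Lipschitz bound tames the singularity on the diagonal, the bound by 1 gives decay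
  far from it. Neither depends on \<open>n\<close>.\<close>

lemma cutoff_diff_power2_le:
  "(cutoff n x - cutoff n y)\<^sup>2 \<le> min 1 ((norm (x - y))\<^sup>2)"
proof -
  have "\<bar>norm x / real (Suc n) - norm y / real (Suc n)\<bar> = \<bar>norm x - norm y\<bar> / real (Suc n)"
    by (simp add: diff_divide_distrib[symmetric])
  also have "\<dots> \<le> \<bar>norm x - norm y\<bar>"
    by (simp add: divide_le_eq mult_le_cancel_left1)
  also have "\<dots> \<le> norm (x - y)" by (rule norm_triangle_ineq3)
  finally have "\<bar>cutoff n x - cutoff n y\<bar> \<le> norm (x - y)"
    unfolding cutoff_def by linarith
  moreover have "\<bar>cutoff n x - cutoff n y\<bar> \<le> 1"
    unfolding cutoff_def by linarith
  ultimately show ?thesis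
    using power_mono[of "\<bar>cutoff n x - cutoff n y\<bar>" _ 2]
    by (metis abs_ge_zero min.bounded_iff one_power2 power2_abs)
qed

lemma cutoff_tendsto_1: "(\<lambda>n. cutoff n x) \<longlonglongrightarrow> 1"
proof -
  have "(\<lambda>n. max 0 (min 1 (2 - norm x / real (Suc n)))) \<longlonglongrightarrow> max 0 (min 1 (2 - 0))"
    by (intro tendsto_intros LIMSEQ_Suc[OF lim_const_over_n])
  then show ?thesis by (simp add: cutoff_def)
qed

lemma cutoff_mult_power2_le: "(cutoff n x * a)\<^sup>2 \<le> a\<^sup>2"
  using cutoff_nonneg[of n x] cutoff_le_1[of n x]
  by (simp add: power_mult_distrib mult_left_le_one_le power_le_one)

text \<open>A discrete product rule: the increment splits into the cutoff times the increment of
  \<open>u\<close>, plus \<open>u\<close> times the increment of the cutoff. The right-hand side is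
  free of \<open>n\<close> and serves as the dominating function.\<close>

lemma gagliardo_integrand_cutoff_le:
  fixes u :: "'a::euclidean_space \<Rightarrow> real"
  shows "gagliardo_integrand s (\<lambda>x. cutoff n x * u x) (\<lambda>x. cutoff n x * u x) z
    \<le> 2 * gagliardo_integrand s u u z + 2 * ((u (fst z))\<^sup>2 *
        (min 1 ((norm (fst z - snd z))\<^sup>2) / norm (fst z - snd z) powr (real DIM('a) + 2 * s)))"
proof -
  obtain x y where z: "z = (x, y)" by force
  have "(cutoff n x * u x - cutoff n y * u y)\<^sup>2 =
      (cutoff n y * (u x - u y) - u x * (cutoff n y - cutoff n x))\<^sup>2"
    by (simp add: algebra_simps)
  also have "\<dots> \<le> 2 * (cutoff n y * (u x - u y))\<^sup>2 + 2 * (u x * (cutoff n y - cutoff n x))\<^sup>2"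
    by (rule diff_power2_le)
  also have "\<dots> \<le> 2 * (u x - u y)\<^sup>2 + 2 * ((u x)\<^sup>2 * min 1 ((norm (x - y))\<^sup>2))"
    using cutoff_mult_power2_le[of n y "u x - u y"] cutoff_diff_power2_le[of n y x]
      mult_left_mono[of "(cutoff n y - cutoff n x)\<^sup>2" "min 1 ((norm (x - y))\<^sup>2)" "(u x)\<^sup>2"]
    by (simp add: power_mult_distrib norm_minus_commute)
  finally show ?thesis
    unfolding gagliardo_integrand_diag z fst_conv snd_conv times_divide_eq_right
      add_divide_distrib[symmetric]
    by (intro divide_right_mono) auto
qed

text \<open>Dominated convergence. The majorant is integrable because \<open>0 < s < 1\<close>
  places the exponent \<open>DIM('a) + 2 * s\<close> strictly between \<open>DIM('a)\<close> and
  \<open>DIM('a) + 2\<close>.\<close>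

lemma
  fixes u :: "'a::euclidean_space \<Rightarrow> real"
  assumes u: "u \<in> Hs s" and s: "0 < s" "s < 1"
  shows Hs_cutoff: "(\<lambda>x. cutoff n x * u x) \<in> Hs s"
    and gagliardo_cutoff_tendsto:
      "(\<lambda>n. gagliardo s (\<lambda>x. cutoff n x * u x)) \<longlonglongrightarrow> gagliardo s u"
    and l2norm_cutoff_tendsto:
      "(\<lambda>n. l2norm (\<lambda>x. cutoff n x * u x)) \<longlonglongrightarrow> l2norm u"
proof -
  note [measurable] = HsD(1)[OF u]
  let ?w = "\<lambda>z. 2 * gagliardo_integrand s u u z + 2 * ((u (fst z))\<^sup>2 *
        (min 1 ((norm (fst z - snd z))\<^sup>2) / norm (fst z - snd z) powr (real DIM('a) + 2 * s)))"
  let ?g = "\<lambda>n. gagliardo_integrand s (\<lambda>x. cutoff n x * u x) (\<lambda>x. cutoff n x * u x)"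
  have w: "integrable (lborel \<Otimes>\<^sub>M lborel) ?w"
    using s by (intro Bochner_Integration.integrable_add integrable_mult_right HsD(3)[OF u] HsD(2)[OF u]
        integrable_mult_convolution_kernel integrable_min_norm_power2_div_powr) auto
  have gl: "AE z in lborel \<Otimes>\<^sub>M lborel. (\<lambda>n. ?g n z) \<longlonglongrightarrow> gagliardo_integrand s u u z"
  proof (intro AE_I2)
    fix z :: "'a \<times> 'a"
    have "(\<lambda>n. (cutoff n (fst z) * u (fst z) - cutoff n (snd z) * u (snd z))\<^sup>2 /
          norm (fst z - snd z) powr (real DIM('a) + 2 * s))
      \<longlonglongrightarrow> (1 * u (fst z) - 1 * u (snd z))\<^sup>2 / norm (fst z - snd z) powr (real DIM('a) + 2 * s)"
      unfolding divide_inverse by (intro tendsto_intros cutoff_tendsto_1)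
    then show "(\<lambda>n. ?g n z) \<longlonglongrightarrow> gagliardo_integrand s u u z"
      by (simp add: gagliardo_integrand_diag)
  qed
  have gb: "AE z in lborel \<Otimes>\<^sub>M lborel. norm (?g n z) \<le> ?w z" for n
    using gagliardo_integrand_cutoff_le[of s n u] gagliardo_integrand_nonneg[of s "\<lambda>x. cutoff n x * u x"]
    by (intro AE_I2) simp
  have m1: "gagliardo_integrand s u u \<in> borel_measurable (lborel \<Otimes>\<^sub>M lborel)" by measurable
  have m2: "?g n \<in> borel_measurable (lborel \<Otimes>\<^sub>M lborel)" for n by measurable
  have i: "integrable (lborel \<Otimes>\<^sub>M lborel) (?g n)" for n
    by (rule integrable_dominated_convergence2[OF m1 m2 w gl gb])
  have i2: "integrable lborel (\<lambda>x. (cutoff n x * u x)\<^sup>2)" for n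
    using HsD(2)[OF u] by (rule Bochner_Integration.integrable_bound)
      (auto simp: cutoff_mult_power2_le)
  show "(\<lambda>x. cutoff n x * u x) \<in> Hs s"
    by (intro HsI i i2) measurable
  show "(\<lambda>n. gagliardo s (\<lambda>x. cutoff n x * u x)) \<longlonglongrightarrow> gagliardo s u"
    unfolding gagliardo_def by (rule integral_dominated_convergence[OF m1 m2 w gl gb])
  have "(\<lambda>n. (cutoff n x * u x)\<^sup>2) \<longlonglongrightarrow> (1 * u x)\<^sup>2" for x
    by (intro tendsto_intros cutoff_tendsto_1)
  then have "(\<lambda>n. LINT x|lborel. (cutoff n x * u x)\<^sup>2) \<longlonglongrightarrow> (LINT x|lborel. (u x)\<^sup>2)"
    by (intro integral_dominated_convergence[OF _ _ HsD(2)[OF u]])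
      (auto simp: cutoff_mult_power2_le)
  then show "(\<lambda>n. l2norm (\<lambda>x. cutoff n x * u x)) \<longlonglongrightarrow> l2norm u"
    unfolding l2norm_def power2_abs by (rule tendsto_real_sqrt)
qed

lemma borel_measurable_nl_integrand [measurable]:
  assumes [measurable]: "u \<in> borel_measurable borel"
  shows "nl_integrand b \<beta> u \<in> borel_measurable borel"
  unfolding nl_integrand_def by measurable

lemma nl_integrand_nonneg: "0 \<le> nl_integrand b \<beta> u x"
  by (simp add: nl_integrand_def)

lemma two_plus_pos: "0 < 2 + 2 * (\<beta>::real)\<^sup>2"
  by (simp add: add_pos_nonneg)

lemma nl_integral_cutoff_tendsto:
  fixes u :: "'a::euclidean_space \<Rightarrow> real"
  assumes [measurable]: "u \<in> borel_measurable borel" and int: "integrable lborel (nl_integrand b \<beta> u)"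
  shows "(\<lambda>n. nl_integral b \<beta> (\<lambda>x. cutoff n x * u x)) \<longlonglongrightarrow> nl_integral b \<beta> u"
  unfolding nl_integral_def
proof (rule integral_dominated_convergence[OF _ _ int])
  show "AE x in lborel. (\<lambda>n. nl_integrand b \<beta> (\<lambda>x. cutoff n x * u x) x) \<longlonglongrightarrow> nl_integrand b \<beta> u x"
  proof (intro AE_I2)
    fix x
    have "(\<lambda>n. norm x powr (- b) * \<bar>cutoff n x * u x\<bar> powr (2 + 2 * \<beta>\<^sup>2))
        \<longlonglongrightarrow> norm x powr (- b) * \<bar>1 * u x\<bar> powr (2 + 2 * \<beta>\<^sup>2)"
      using two_plus_pos[of \<beta>]
      by (intro tendsto_mult tendsto_const tendsto_powr' tendsto_rabs cutoff_tendsto_1) auto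
    then show "(\<lambda>n. nl_integrand b \<beta> (\<lambda>x. cutoff n x * u x) x) \<longlonglongrightarrow> nl_integrand b \<beta> u x"
      by (simp add: nl_integrand_def)
  qed
  have "\<bar>cutoff n x * u x\<bar> \<le> \<bar>u x\<bar>" for n x
    using cutoff_nonneg[of n x] cutoff_le_1[of n x] by (simp add: abs_mult mult_left_le_one_le)
  then show "AE x in lborel. norm (nl_integrand b \<beta> (\<lambda>x. cutoff n x * u x) x) \<le> nl_integrand b \<beta> u x" for n
    using two_plus_pos[of \<beta>]
    by (intro AE_I2) (auto simp: nl_integrand_def intro!: mult_left_mono powr_mono2)
qed measurable

lemma nl_integral_eq_0:
  assumes "AE x in lborel. u x = 0"
  shows "nl_integral b \<beta> u = 0"
  unfolding nl_integral_def
  by (rule integral_eq_zero_AE) (use assms in \<open>auto simp: nl_integrand_def\<close>)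

lemma AE_eq_0_if_l2norm_eq_0:
  assumes "integrable lborel (\<lambda>x. (u x)\<^sup>2)" "l2norm u = 0"
  shows "AE x in lborel. u x = 0"
  using assms integral_nonneg_eq_0_iff_AE[OF assms(1)] l2norm_power2[of u] by simp

lemma potential_integral_le:
  fixes V u :: "'a::euclidean_space \<Rightarrow> real"
  assumes V: "V \<in> Linf_loc" "AE x in lborel. x \<in> cball 0 R \<longrightarrow> \<bar>V x\<bar> \<le> M"
    and [measurable]: "u \<in> borel_measurable borel" and int: "integrable lborel (\<lambda>x. (u x)\<^sup>2)"
    and supp: "\<And>x. R < norm x \<Longrightarrow> u x = 0"
  shows "integrable lborel (\<lambda>x. V x * (u x)\<^sup>2)"
    and "(LINT x|lborel. V x * (u x)\<^sup>2) \<le> M * (l2norm u)\<^sup>2"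
proof -
  have [measurable]: "V \<in> borel_measurable borel" using V(1) by (simp add: Linf_loc_def)
  have ae: "AE x in lborel. \<bar>V x * (u x)\<^sup>2\<bar> \<le> M * (u x)\<^sup>2"
    using V(2)
  proof eventually_elim
    case (elim x)
    then show ?case
      using supp[of x] by (cases "norm x \<le> R") (auto simp: abs_mult intro: mult_right_mono)
  qed
  have iM: "integrable lborel (\<lambda>x. M * (u x)\<^sup>2)" using int by simp
  show i: "integrable lborel (\<lambda>x. V x * (u x)\<^sup>2)"
    by (rule Bochner_Integration.integrable_bound[OF iM]) (use ae in auto)
  show "(LINT x|lborel. V x * (u x)\<^sup>2) \<le> M * (l2norm u)\<^sup>2"
    unfolding l2norm_power2 integral_mult_right_zero[symmetric]
    by (rule integral_mono_AE[OF i iM]) (use ae in auto)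
qed

section \<open>Concentration by dilation\<close>

text \<open>Mass-preserving dilations multiply kinetic minus nonlinear energy, which is negative, by
  \<open>\<tau> powr (2 * s)\<close>. Compact support keeps the potential energy bounded
  meanwhile.\<close>

lemma min_energy_minus_infinity:
  fixes V w :: "'a::euclidean_space \<Rightarrow> real"
  assumes s: "0 < s" and \<beta>: "real DIM('a) * \<beta>\<^sup>2 = 2 * s - b"
    and V: "V \<in> Linf_loc"
    and w: "w \<in> Hs s" and supp: "\<And>x. R < norm x \<Longrightarrow> w x = 0" and L: "0 < l2norm w"
    and neg: "frac_energy s w * l2norm w powr (2 * \<beta>\<^sup>2) < a / (1 + \<beta>\<^sup>2) * nl_integral b \<beta> w"
  shows "min_energy s b \<beta> V a = - \<infinity>"
proof -
  let ?N = "real DIM('a)"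
  obtain M where M: "AE x in lborel. x \<in> cball 0 R \<longrightarrow> \<bar>V x\<bar> \<le> M"
    using V compact_cball[of "0::'a" R] unfolding Linf_loc_def by blast
  define l where "l = l2norm w"
  \<comment> \<open>\<open>K\<close> is the kinetic minus the nonlinear energy of the normalised
    function \<open>w / l\<close>.\<close>
  define K where "K = (frac_energy s w * l powr (2 * \<beta>\<^sup>2) - a / (1 + \<beta>\<^sup>2) * nl_integral b \<beta> w)
      / l powr (2 + 2 * \<beta>\<^sup>2)"
  have l: "0 < l" using L by (simp add: l_def)
  have K: "K < 0"
    using neg l by (simp add: K_def l_def divide_neg_pos)
  define u where "u \<tau> = (\<lambda>x. \<tau> powr (?N / 2) / l * w (\<tau> *\<^sub>R x))" for \<tau> :: real
  have u: "u \<tau> \<in> admissible s V" "energy s b \<beta> V a (u \<tau>) \<le> \<tau> powr (2 * s) * K + M" if "1 \<le> \<tau>" for \<tau>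
  proof -
    have \<tau>: "0 < \<tau>" using that by simp
    have k: "(\<tau> powr (?N / 2) / l)\<^sup>2 = \<tau> powr ?N / l\<^sup>2"
      by (simp add: power_divide power2_eq_square flip: powr_add)
    have uH: "u \<tau> \<in> Hs s" and
      g: "gagliardo s (u \<tau>) = \<tau> powr ?N / l\<^sup>2 * \<tau> powr (2 * s - ?N) * gagliardo s w" and
      n: "(l2norm (u \<tau>))\<^sup>2 = \<tau> powr ?N / l\<^sup>2 * \<tau> powr (- ?N) * l\<^sup>2" and
      nl: "nl_integral b \<beta> (u \<tau>) = \<bar>\<tau> powr (?N / 2) / l\<bar> powr (2 + 2 * \<beta>\<^sup>2) *
        \<tau> powr (b - ?N) * nl_integral b \<beta> w"
      using Hs_scale(1-3)[OF w \<tau>, where k = "\<tau> powr (?N / 2) / l"]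
        Hs_scale(4)[OF w \<tau>, where k = "\<tau> powr (?N / 2) / l" and b = b and \<beta> = \<beta>]
      unfolding u_def k l_def[symmetric] by auto
    have n1: "(l2norm (u \<tau>))\<^sup>2 = 1"
      using n \<tau> l by (simp add: powr_minus)
    have "gagliardo s (u \<tau>) = \<tau> powr (2 * s) * gagliardo s w / l\<^sup>2"
      unfolding g using \<tau> by (simp add: powr_diff)
    then have fe: "frac_energy s (u \<tau>) = \<tau> powr (2 * s) * (frac_energy s w / l\<^sup>2)"
      by (simp add: frac_energy_gagliardo)
    \<comment> \<open>Mass criticality: the relation between \<open>\<beta>\<close>,
      \<open>s\<close> and \<open>b\<close> gives the nonlinear term the same growth exponent as the
      kinetic one.\<close>
    have "?N / 2 * (2 + 2 * \<beta>\<^sup>2) + (b - ?N) = 2 * s"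
      using \<beta> by (simp add: algebra_simps)
    then have "\<bar>\<tau> powr (?N / 2) / l\<bar> powr (2 + 2 * \<beta>\<^sup>2) * \<tau> powr (b - ?N) =
        \<tau> powr (2 * s) / l powr (2 + 2 * \<beta>\<^sup>2)"
      using l by (simp add: powr_divide powr_powr flip: powr_add)
    then have nl': "nl_integral b \<beta> (u \<tau>) =
        \<tau> powr (2 * s) * (nl_integral b \<beta> w / l powr (2 + 2 * \<beta>\<^sup>2))"
      unfolding nl by simp
    \<comment> \<open>For \<open>1 \<le> \<tau>\<close> the dilation shrinks supports, so one bound
      \<open>M\<close> of \<open>V\<close> on the original ball serves all
      \<open>\<tau>\<close>.\<close>
    have supp': "u \<tau> x = 0" if "R < norm x" for x
    proof -
      have "norm x \<le> norm (\<tau> *\<^sub>R x)"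
        using \<open>1 \<le> \<tau>\<close> by (simp add: mult_le_cancel_right1)
      then show ?thesis using that supp[of "\<tau> *\<^sub>R x"] by (simp add: u_def)
    qed
    note Vu = potential_integral_le[OF V M HsD(1,2)[OF uH] supp']
    show "u \<tau> \<in> admissible s V"
      using uH Vu n1 by (simp add: admissible_def energy_space_def)
    have "frac_energy s w / l\<^sup>2 = frac_energy s w * l powr (2 * \<beta>\<^sup>2) / l powr (2 + 2 * \<beta>\<^sup>2)"
      using l by (simp add: powr_add)
    then have "frac_energy s (u \<tau>) - a / (1 + \<beta>\<^sup>2) * nl_integral b \<beta> (u \<tau>) = \<tau> powr (2 * s) * K"
      unfolding fe nl' K_def by (simp add: diff_divide_distrib right_diff_distrib)
    then show "energy s b \<beta> V a (u \<tau>) \<le> \<tau> powr (2 * s) * K + M"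
      using Vu(2) n1 by (simp add: energy_def)
  qed
  have "filterlim (\<lambda>\<tau>::real. \<tau> powr (2 * s)) at_top at_top"
    using s by real_asymp
  then have lim: "filterlim (\<lambda>\<tau>. K * \<tau> powr (2 * s)) at_bot at_top"
    by (rule filterlim_tendsto_neg_mult_at_bot[OF tendsto_const K])
  show ?thesis
  proof (rule ereal_bot)
    fix B
    have "eventually (\<lambda>\<tau>. K * \<tau> powr (2 * s) \<le> B - M) at_top"
      using lim by (simp add: filterlim_at_bot)
    then have "eventually (\<lambda>\<tau>. 1 \<le> \<tau> \<and> \<tau> powr (2 * s) * K + M \<le> B) at_top"
      using eventually_ge_at_top[of 1] by eventually_elim (simp add: mult.commute)
    then obtain \<tau> where \<tau>: "1 \<le> \<tau>" "\<tau> powr (2 * s) * K + M \<le> B"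
      using eventually_happens[of _ "at_top :: real filter"] by auto
    have "min_energy s b \<beta> V a \<le> ereal (energy s b \<beta> V a (u \<tau>))"
      unfolding min_energy_def by (intro INF_lower u \<tau>)
    also have "\<dots> \<le> ereal B" using u(2)[OF \<tau>(1)] \<tau>(2) by simp
    finally show "min_energy s b \<beta> V a \<le> ereal B" .
  qed
qed

text \<open>The inequality, being strict, survives a cutoff; scaling then concentrates the cut-off function.\<close>

lemma min_energy_minus_infinity_if_gn_violated:
  fixes V w :: "'a::euclidean_space \<Rightarrow> real"
  assumes s: "0 < s" "s < 1" and \<beta>: "real DIM('a) * \<beta>\<^sup>2 = 2 * s - b" "\<beta> \<noteq> 0"
    and V: "V \<in> Linf_loc"
    and w: "w \<in> Hs s" and nl: "integrable lborel (nl_integrand b \<beta> w)"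
    and neg: "frac_energy s w * l2norm w powr (2 * \<beta>\<^sup>2) < a / (1 + \<beta>\<^sup>2) * nl_integral b \<beta> w"
  shows "min_energy s b \<beta> V a = - \<infinity>"
proof -
  define v where "v n = (\<lambda>x. cutoff n x * w x)" for n
  have v: "v n \<in> Hs s" for n
    unfolding v_def by (rule Hs_cutoff[OF w s])
  have "(\<lambda>n. frac_energy s (v n) * l2norm (v n) powr (2 * \<beta>\<^sup>2) - a / (1 + \<beta>\<^sup>2) * nl_integral b \<beta> (v n))
    \<longlonglongrightarrow> frac_energy s w * l2norm w powr (2 * \<beta>\<^sup>2) - a / (1 + \<beta>\<^sup>2) * nl_integral b \<beta> w"
    unfolding frac_energy_gagliardo v_def using \<beta>(2)
    by (intro tendsto_intros gagliardo_cutoff_tendsto[OF w s] l2norm_cutoff_tendsto[OF w s]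
        nl_integral_cutoff_tendsto HsD(1)[OF w] nl tendsto_powr') (auto simp: l2norm_nonneg)
  then have "eventually (\<lambda>n. frac_energy s (v n) * l2norm (v n) powr (2 * \<beta>\<^sup>2)
      - a / (1 + \<beta>\<^sup>2) * nl_integral b \<beta> (v n) < 0) sequentially"
    using neg by (intro order_tendstoD) auto
  then obtain n where n: "frac_energy s (v n) * l2norm (v n) powr (2 * \<beta>\<^sup>2)
      < a / (1 + \<beta>\<^sup>2) * nl_integral b \<beta> (v n)"
    by (auto simp: eventually_sequentially)
  \<comment> \<open>A truncation of norm zero would make both sides of the strict inequality
    vanish.\<close>
  have "l2norm (v n) \<noteq> 0"
  proof
    assume 0: "l2norm (v n) = 0"
    then have "nl_integral b \<beta> (v n) = 0"
      using nl_integral_eq_0 AE_eq_0_if_l2norm_eq_0[OF HsD(2)[OF v]] by blast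
    then show False using n 0 by simp
  qed
  then have L: "0 < l2norm (v n)"
    using l2norm_nonneg[of "v n"] by simp
  show ?thesis
    by (rule min_energy_minus_infinity[OF s(1) \<beta>(1) V v _ L n, of "2 * real (Suc n)"])
      (simp add: v_def cutoff_eq_0)
qed

subsection \<open>Strong compactness in mean square\<close>

text \<open>The Riesz--Fischer theorem, with the almost everywhere convergent subsequence kept.
  Along it, squared distances are below \<open>(1 / 4) ^ k\<close>; Fatou's lemma identifies the
  pointwise limit as the limit in mean square.\<close>

lemma L2_Cauchy_convergent:
  fixes f :: "nat \<Rightarrow> 'a \<Rightarrow> real"
  assumes meas [measurable]: "\<And>n. f n \<in> borel_measurable M"
    and sq: "\<And>n. integrable M (\<lambda>x. (f n x)\<^sup>2)"
    and Cauchy: "\<And>e. 0 < e \<Longrightarrow> \<exists>N. \<forall>m\<ge>N. \<forall>n\<ge>N. (LINT x|M. (f m x - f n x)\<^sup>2) < e"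
  obtains r g where "strict_mono (r :: nat \<Rightarrow> nat)" "g \<in> borel_measurable M"
    "integrable M (\<lambda>x. (g x)\<^sup>2)" "AE x in M. (\<lambda>n. f (r n) x) \<longlonglongrightarrow> g x"
    "(\<lambda>n. LINT x|M. (f (r n) x - g x)\<^sup>2) \<longlonglongrightarrow> 0"
proof -
  note int = integrable_diff_power2[OF meas meas sq sq]
  have "\<exists>r. \<forall>k. (\<forall>m\<ge>r k. \<forall>n\<ge>r k. (LINT x|M. (f m x - f n x)\<^sup>2) < (1 / 4) ^ k) \<and> r k < r (Suc k)"
  proof (rule dependent_nat_choice)
    show "\<exists>N. \<forall>m\<ge>N. \<forall>n\<ge>N. (LINT x|M. (f m x - f n x)\<^sup>2) < (1 / 4) ^ 0"
      by (rule Cauchy) simp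
  next
    fix N0 k
    obtain N where "\<forall>m\<ge>N. \<forall>n\<ge>N. (LINT x|M. (f m x - f n x)\<^sup>2) < (1 / 4) ^ Suc k"
      using Cauchy[of "(1 / 4) ^ Suc k"] by auto
    then show "\<exists>N. (\<forall>m\<ge>N. \<forall>n\<ge>N. (LINT x|M. (f m x - f n x)\<^sup>2) < (1 / 4) ^ Suc k) \<and> N0 < N"
      by (intro exI[of _ "max N (Suc N0)"]) auto
  qed
  then obtain r where r: "\<And>k m n. r k \<le> m \<Longrightarrow> r k \<le> n \<Longrightarrow> (LINT x|M. (f m x - f n x)\<^sup>2) < (1 / 4) ^ k"
    and mono: "\<And>k. r k < r (Suc k)"
    by blast
  have rm: "strict_mono r" using mono by (rule strict_mono_Suc_iff[THEN iffD2, rule_format])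
  define d where "d k x = f (r (Suc k)) x - f (r k) x" for k x
  have [measurable]: "d k \<in> borel_measurable M" for k
    unfolding d_def by measurable
  \<comment> \<open>The weight \<open>2 ^ k\<close> is small enough for the integrals to sum like
    \<open>(1 / 2) ^ k\<close>, and large enough to control the unsquared increments below.\<close>
  have "(\<integral>\<^sup>+x. (\<Sum>k. ennreal (2 ^ k * (d k x)\<^sup>2)) \<partial>M) = (\<Sum>k. \<integral>\<^sup>+x. ennreal (2 ^ k * (d k x)\<^sup>2) \<partial>M)"
    by (rule nn_integral_suminf) measurable
  also have "\<dots> = (\<Sum>k. ennreal (2 ^ k * (LINT x|M. (d k x)\<^sup>2)))"
    using int unfolding d_def
    by (subst nn_integral_eq_integral) auto
  also have "\<dots> \<le> (\<Sum>k. ennreal ((1 / 2) ^ k))"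
  proof (intro suminf_le ennreal_leI)
    fix k
    have "(LINT x|M. (d k x)\<^sup>2) \<le> (1 / 4) ^ k"
      unfolding d_def using r[of k "r (Suc k)" "r k"] mono[of k] by simp
    then have "2 ^ k * (LINT x|M. (d k x)\<^sup>2) \<le> 2 ^ k * (1 / 4) ^ k"
      by (intro mult_left_mono) auto
    also have "\<dots> = (1 / 2) ^ k"
      by (simp flip: power_mult_distrib)
    finally show "2 ^ k * (LINT x|M. (d k x)\<^sup>2) \<le> (1 / 2) ^ k" .
  qed auto
  also have "\<dots> < \<infinity>"
    by (subst suminf_ennreal2) (auto intro!: summable_geometric)
  finally have "AE x in M. (\<Sum>k. ennreal (2 ^ k * (d k x)\<^sup>2)) \<noteq> \<infinity>"
    by (intro nn_integral_noteq_infinite) auto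
  then have conv: "AE x in M. convergent (\<lambda>n. f (r n) x)"
  proof eventually_elim
    case (elim x)
    then have s: "summable (\<lambda>k. 2 ^ k * (d k x)\<^sup>2)"
      by (intro summable_suminf_not_top) auto
    \<comment> \<open>Either the increment is at most \<open>(1 / 2) ^ k\<close>, or
      \<open>2 ^ k * \<bar>d k x\<bar>\<close> is at least 1 and the square dominates.\<close>
    have "\<bar>d k x\<bar> \<le> 2 ^ k * (d k x)\<^sup>2 + (1 / 2) ^ k" for k
    proof (cases "\<bar>d k x\<bar> \<le> (1 / 2) ^ k")
      case False
      then have "1 \<le> 2 ^ k * \<bar>d k x\<bar>"
        by (simp add: power_divide field_simps)
      then have "\<bar>d k x\<bar> * 1 \<le> \<bar>d k x\<bar> * (2 ^ k * \<bar>d k x\<bar>)"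
        by (intro mult_left_mono) auto
      then show ?thesis
        by (simp add: power2_eq_square mult.left_commute add_increasing2 flip: abs_mult)
    qed (simp add: add_increasing)
    then have "summable (\<lambda>k. d k x)"
      by (intro summable_comparison_test[OF _ summable_add[OF s summable_geometric[of "1 / 2"]]])
        auto
    then have "convergent (\<lambda>n. f (r 0) x + (\<Sum>k<n. d k x))"
      by (intro convergent_add convergent_const) (simp add: summable_iff_convergent)
    moreover have "(\<Sum>k<n. d k x) = f (r n) x - f (r 0) x" for n
      unfolding d_def by (rule sum_lessThan_telescope)
    ultimately show ?case by simp
  qed
  define g where "g x = lim (\<lambda>n. f (r n) x)" for x
  have gm [measurable]: "g \<in> borel_measurable M"
    unfolding g_def[abs_def] by measurable
  have lim: "AE x in M. (\<lambda>n. f (r n) x) \<longlonglongrightarrow> g x"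
    using conv by eventually_elim (simp add: g_def convergent_LIMSEQ_iff)
  have diff: "integrable M (\<lambda>x. (f (r n) x - g x)\<^sup>2)" "(LINT x|M. (f (r n) x - g x)\<^sup>2) \<le> (1 / 4) ^ k"
    if "k \<le> n" for k n
  proof -
    have ae: "AE x in M. (\<lambda>m. (f (r n) x - f (r m) x)\<^sup>2) \<longlonglongrightarrow> (f (r n) x - g x)\<^sup>2"
      using lim by eventually_elim (intro tendsto_intros)
    have ev: "\<forall>\<^sub>F m in sequentially. (LINT x|M. (f (r n) x - f (r m) x)\<^sup>2) \<le> (1 / 4) ^ k"
      using eventually_ge_at_top[of k]
    proof eventually_elim
      case (elim m)
      then show ?case
        using r[of k "r n" "r m"] that by (simp add: strict_mono_less_eq[OF rm])
    qed
    show "integrable M (\<lambda>x. (f (r n) x - g x)\<^sup>2)" "(LINT x|M. (f (r n) x - g x)\<^sup>2) \<le> (1 / 4) ^ k"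
      by (rule fatou_integral_le[OF int _ _ ae ev]; simp)+
  qed
  have "(\<lambda>n. LINT x|M. (f (r n) x - g x)\<^sup>2) \<longlonglongrightarrow> 0"
    using diff(2)
    by (intro tendsto_sandwich[OF _ _ tendsto_const LIMSEQ_realpow_zero[of "1 / 4"]]) auto
  moreover have "integrable M (\<lambda>x. (g x)\<^sup>2)"
    using integrable_diff_power2[OF meas _ sq diff(1)[OF order_refl], of 0 "r 0"] by simp
  ultimately show thesis
    using that rm gm lim by blast
qed

section \<open>Averages over the cells of a grid\<close>

text \<open>For \<open>0 < h\<close>, the half-open cube of side \<open>h\<close> containing
  \<open>x\<close>. Indexing cells by points instead of integer vectors makes
  \<open>cell_average\<close> directly a function of \<open>x\<close>.\<close>

definition grid_cell :: "real \<Rightarrow> 'a::euclidean_space \<Rightarrow> 'a set" where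
  "grid_cell h x = {y. \<forall>i\<in>Basis. \<lfloor>(y \<bullet> i) / h\<rfloor> = \<lfloor>(x \<bullet> i) / h\<rfloor>}"

definition cell_average :: "real \<Rightarrow> ('a::euclidean_space \<Rightarrow> real) \<Rightarrow> 'a \<Rightarrow> real" where
  "cell_average h u x = (LINT y|lborel. indicator (grid_cell h x) y * u y) / h ^ DIM('a)"

lemma grid_cell_measurable_pair [measurable]:
  "Measurable.pred (lborel \<Otimes>\<^sub>M lborel) (\<lambda>z. snd z \<in> grid_cell h (fst z :: 'a::euclidean_space))"
  unfolding grid_cell_def mem_Collect_eq by measurable

lemma grid_cell_measurable [measurable]: "grid_cell h x \<in> sets borel"
proof -
  have "Measurable.pred borel (\<lambda>y. \<forall>i\<in>Basis. \<lfloor>(y \<bullet> i) / h\<rfloor> = \<lfloor>(x \<bullet> i) / h\<rfloor>)"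
    by measurable
  then show ?thesis by (simp add: grid_cell_def pred_def)
qed

text \<open>The cell lies between an open and a closed box with the same corners, and these have
  equal volume.\<close>

lemma emeasure_grid_cell:
  fixes x :: "'a::euclidean_space"
  assumes h: "0 < h"
  shows "emeasure lborel (grid_cell h x) = ennreal (h ^ DIM('a))"
proof -
  define a where "a = (\<Sum>i\<in>Basis. (h * \<lfloor>(x \<bullet> i) / h\<rfloor>) *\<^sub>R i)"
  have a: "a \<bullet> i = h * \<lfloor>(x \<bullet> i) / h\<rfloor>" if "i \<in> Basis" for i
    using that by (simp add: a_def)
  let ?b = "a + h *\<^sub>R One"
  have b: "?b \<bullet> i = a \<bullet> i + h" if "i \<in> Basis" for i
    using that by (simp add: inner_add_left)
  have fl: "\<lfloor>(y \<bullet> i) / h\<rfloor> = \<lfloor>(x \<bullet> i) / h\<rfloor> \<longleftrightarrow> a \<bullet> i \<le> y \<bullet> i \<and> y \<bullet> i < a \<bullet> i + h"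
    if "i \<in> Basis" for y i
    using h by (simp add: floor_eq_iff a[OF that] field_simps)
  have sub: "box a ?b \<subseteq> grid_cell h x" "grid_cell h x \<subseteq> cbox a ?b"
    using b by (auto simp: grid_cell_def fl mem_box less_imp_le)
  have v: "(\<Prod>i\<in>Basis. (?b - a) \<bullet> i) = h ^ DIM('a)" by simp
  have 1: "emeasure lborel (box a ?b) = ennreal (h ^ DIM('a))"
    by (subst emeasure_lborel_box) (use h b v in \<open>auto simp: less_imp_le\<close>)
  have 2: "emeasure lborel (cbox a ?b) = ennreal (h ^ DIM('a))"
    by (subst emeasure_lborel_cbox) (use h b v in \<open>auto simp: less_imp_le\<close>)
  show ?thesis
    using emeasure_mono[OF sub(1), of lborel] emeasure_mono[OF sub(2), of lborel] 1 2
    by (intro antisym) auto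
qed

lemma norm_diff_grid_cell_le:
  fixes x :: "'a::euclidean_space" and h :: real
  assumes h: "0 < h" and y: "y \<in> grid_cell h x"
  shows "norm (x - y) \<le> DIM('a) * h"
proof -
  have "\<bar>(x - y) \<bullet> i\<bar> \<le> h" if i: "i \<in> Basis" for i
  proof -
    have "\<lfloor>(y \<bullet> i) / h\<rfloor> = \<lfloor>(x \<bullet> i) / h\<rfloor>" using y i by (simp add: grid_cell_def)
    then have "\<bar>(x \<bullet> i) / h - (y \<bullet> i) / h\<bar> \<le> 1" by linarith
    also have "(x \<bullet> i) / h - (y \<bullet> i) / h = ((x - y) \<bullet> i) / h"
      by (simp add: inner_diff_left diff_divide_distrib)
    finally show ?thesis using h by (simp add: pos_divide_le_eq)
  qed
  then have "(\<Sum>i\<in>Basis. \<bar>(x - y) \<bullet> i\<bar>) \<le> of_nat DIM('a) * h"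
    by (rule sum_bounded_above)
  then show ?thesis using norm_le_l1[of "x - y"] by linarith
qed

text \<open>A cell is determined by the integer vector of its floors. \<open>restrict\<close> makes
  these vectors extensional, so that they lie in a countable product.\<close>

lemma countable_grid_cells: "countable (range (grid_cell h :: 'a::euclidean_space \<Rightarrow> 'a set))"
proof -
  let ?c = "\<lambda>x::'a. restrict (\<lambda>i. \<lfloor>(x \<bullet> i) / h\<rfloor>) Basis"
  let ?G = "\<lambda>k. {y::'a. \<forall>i\<in>Basis. \<lfloor>(y \<bullet> i) / h\<rfloor> = k i}"
  have "countable (Pi\<^sub>E (Basis :: 'a set) (\<lambda>_. UNIV :: int set))"
    by (intro countable_PiE) auto
  then have "countable (range ?c)"
    by (rule countable_subset[rotated]) auto
  then have "countable (?G ` range ?c)" by simp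
  moreover have "range (grid_cell h :: 'a \<Rightarrow> 'a set) = ?G ` range ?c"
    by (auto simp: grid_cell_def[abs_def] image_image)
  ultimately show ?thesis by simp
qed

lemma integrable_indicator_mult:
  fixes u :: "'a \<Rightarrow> real"
  assumes [measurable]: "A \<in> sets M" "u \<in> borel_measurable M"
    and fin: "emeasure M A < \<infinity>" and sq: "integrable M (\<lambda>x. (u x)\<^sup>2)"
  shows "integrable M (\<lambda>x. indicator A x * u x)"
    and "\<bar>LINT x|M. indicator A x * u x\<bar> \<le> measure M A + (LINT x|M. (u x)\<^sup>2)"
proof -
  have "\<bar>t\<bar> \<le> 1 + t\<^sup>2" for t :: real
    using zero_le_power2[of "\<bar>t\<bar> - 1"] zero_le_power2[of t] by (simp add: power2_eq_square algebra_simps)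
  then have le: "\<bar>indicator A x * u x\<bar> \<le> indicator A x + (u x)\<^sup>2" for x
    by (auto simp: indicator_def)
  have iA: "integrable M (indicator A :: 'a \<Rightarrow> real)" using fin by simp
  have i: "integrable M (\<lambda>x. indicator A x + (u x)\<^sup>2)" using iA sq by simp
  show int: "integrable M (\<lambda>x. indicator A x * u x)"
    by (rule Bochner_Integration.integrable_bound[OF i])
      (use le in \<open>auto intro!: order_trans[OF _ abs_ge_self]\<close>)
  have "\<bar>LINT x|M. indicator A x * u x\<bar> \<le> (LINT x|M. \<bar>indicator A x * u x\<bar>)"
    by (rule integral_abs_bound)
  also have "\<dots> \<le> (LINT x|M. indicator A x + (u x)\<^sup>2)"
    using int i le by (intro integral_mono) auto
  also have "\<dots> = measure M A + (LINT x|M. (u x)\<^sup>2)"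
    using iA sq by (simp add: sets.Int_space_eq2)
  finally show "\<bar>LINT x|M. indicator A x * u x\<bar> \<le> measure M A + (LINT x|M. (u x)\<^sup>2)" .
qed

text \<open>The tangent line of \<open>t \<mapsto> (c - t)\<^sup>2\<close> at the mean.\<close>

lemma power2_diff_average_le:
  fixes u :: "'a \<Rightarrow> real"
  assumes A [measurable]: "A \<in> sets M" "u \<in> borel_measurable M"
    and fin: "emeasure M A < \<infinity>" and pos: "0 < measure M A" and sq: "integrable M (\<lambda>x. (u x)\<^sup>2)"
  shows "measure M A * (c - (LINT x|M. indicator A x * u x) / measure M A)\<^sup>2
      \<le> (LINT x|M. indicator A x * (c - u x)\<^sup>2)"
proof -
  define m where "m = (LINT x|M. indicator A x * u x) / measure M A"
  have iA: "integrable M (indicator A :: 'a \<Rightarrow> real)" using fin by simp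
  note iu = integrable_indicator_mult(1)[OF A fin sq]
  have isq: "integrable M (\<lambda>x. indicator A x * (u x)\<^sup>2)"
    by (rule Bochner_Integration.integrable_bound[OF sq]) (auto simp: indicator_def)
  have eq: "(\<lambda>x. indicator A x * ((c - m)\<^sup>2 + 2 * (c - m) * (m - u x))) =
      (\<lambda>x. ((c - m)\<^sup>2 + 2 * (c - m) * m) * indicator A x - 2 * (c - m) * (indicator A x * u x))"
    by (auto simp: fun_eq_iff algebra_simps)
  have eq2: "(\<lambda>x. indicator A x * (c - u x)\<^sup>2) =
      (\<lambda>x. c\<^sup>2 * indicator A x - 2 * c * (indicator A x * u x) + indicator A x * (u x)\<^sup>2)"
    by (auto simp: fun_eq_iff power2_eq_square algebra_simps)
  \<comment> \<open>By the choice of \<open>m\<close>, the linear part \<open>m - u x\<close>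
    integrates to zero over \<open>A\<close>.\<close>
  have "measure M A * (c - m)\<^sup>2 = (LINT x|M. indicator A x * ((c - m)\<^sup>2 + 2 * (c - m) * (m - u x)))"
    unfolding eq using iA iu pos
    by (simp add: sets.Int_space_eq2 m_def) (simp add: field_simps)
  also have "\<dots> \<le> (LINT x|M. indicator A x * (c - u x)\<^sup>2)"
  proof (intro integral_mono mult_left_mono)
    fix x
    have "0 \<le> (m - u x)\<^sup>2" by simp
    then show "(c - m)\<^sup>2 + 2 * (c - m) * (m - u x) \<le> (c - u x)\<^sup>2"
      by (simp add: power2_eq_square algebra_simps)
  qed (unfold eq eq2, use iA iu isq in auto)
  finally show ?thesis unfolding m_def .
qed

lemma borel_measurable_cell_average [measurable]:
  assumes [measurable]: "u \<in> borel_measurable borel"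
  shows "cell_average h u \<in> borel_measurable borel"
proof -
  have "(\<lambda>x. (LINT y|lborel. indicator {z. snd z \<in> grid_cell h (fst z)} (x, y) * u y))
      \<in> borel_measurable lborel"
    by measurable
  then show ?thesis
    unfolding cell_average_def[abs_def] by (simp add: indicator_def)
qed

lemma cell_average_diff:
  assumes h: "0 < h" and u: "u \<in> borel_measurable borel" "integrable lborel (\<lambda>x. (u x)\<^sup>2)"
    and v: "v \<in> borel_measurable borel" "integrable lborel (\<lambda>x. (v x)\<^sup>2)"
  shows "cell_average h (\<lambda>x. u x - v x) x = cell_average h u x - cell_average h v x"
proof -
  have i: "integrable lborel (\<lambda>y. indicator (grid_cell h x) y * u y)"
    "integrable lborel (\<lambda>y. indicator (grid_cell h x) y * v y)"
    using integrable_indicator_mult(1)[of "grid_cell h x" lborel] u v h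
    by (auto simp: emeasure_grid_cell)
  show ?thesis
    unfolding cell_average_def right_diff_distrib
    using i by (simp add: diff_divide_distrib)
qed

text \<open>A fractional Poincare inequality. Within a cell \<open>norm (x - y)\<close> is at most
  \<open>DIM('a) * h\<close>, so the squared increment is at most
  \<open>(DIM('a) * h) powr (DIM('a) + 2 * s)\<close> times the Gagliardo integrand. Dividing by the
  cell volume leaves \<open>h powr (2 * s)\<close>.\<close>

lemma cell_average_L2_close:
  fixes u :: "'a::euclidean_space \<Rightarrow> real" and h s :: real
  assumes u: "u \<in> Hs s" and h: "0 < h" and s: "0 < s"
  shows "integrable lborel (\<lambda>x. (u x - cell_average h u x)\<^sup>2)"
    and "(LINT x|lborel. (u x - cell_average h u x)\<^sup>2)
      \<le> DIM('a) powr (DIM('a) + 2 * s) * h powr (2 * s) * gagliardo s u"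
proof -
  note [measurable] = HsD(1)[OF u]
  let ?N = "DIM('a)"
  define p where "p = ?N + 2 * s"
  define c where "c = (?N * h) powr p / h ^ ?N"
  let ?g = "\<lambda>x y. gagliardo_integrand s u u (x, y)"
  have int: "integrable (lborel \<Otimes>\<^sub>M lborel) (\<lambda>(x, y). ?g x y)"
    using HsD(3)[OF u] by simp
  have ms: "measure lborel (grid_cell h x) = h ^ ?N" for x :: 'a
    using h by (simp add: measure_def emeasure_grid_cell)
  have "AE x in lborel. integrable lborel (\<lambda>y. ?g x y)"
    using lborel_pair.AE_integrable_fst'[OF HsD(3)[OF u]] .
  then have bound: "AE x in lborel. (u x - cell_average h u x)\<^sup>2 \<le> c * (LINT y|lborel. ?g x y)"
  proof eventually_elim
    case (elim x)
    have "h ^ ?N * (u x - cell_average h u x)\<^sup>2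
        \<le> (LINT y|lborel. indicator (grid_cell h x) y * (u x - u y)\<^sup>2)"
      using power2_diff_average_le[of "grid_cell h x" lborel u "u x"] h HsD(2)[OF u]
      by (simp add: ms emeasure_grid_cell cell_average_def)
    also have "\<dots> \<le> (LINT y|lborel. (?N * h) powr p * ?g x y)"
    proof (rule integral_mono')
      show "integrable lborel (\<lambda>y. (?N * h) powr p * ?g x y)" using elim by simp
    next
      fix y
      show "indicator (grid_cell h x) y * (u x - u y)\<^sup>2 \<le> (?N * h) powr p * ?g x y"
      proof (cases "y \<in> grid_cell h x \<and> x \<noteq> y")
        case True
        then have "norm (x - y) powr p \<le> (?N * h) powr p"
          using s h norm_diff_grid_cell_le[of h y x] by (intro powr_mono2) (auto simp: p_def)
        then have "norm (x - y) powr p * ?g x y \<le> (?N * h) powr p * ?g x y"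
          by (intro mult_right_mono gagliardo_integrand_nonneg)
        then show ?thesis
          using True by (simp add: gagliardo_integrand_diag p_def)
      qed (auto simp: gagliardo_integrand_nonneg)
      show "0 \<le> (?N * h) powr p * ?g x y" by (simp add: gagliardo_integrand_nonneg)
    qed
    finally show ?case using h by (simp add: c_def field_simps)
  qed
  have i1: "integrable lborel (\<lambda>x. c * (LINT y|lborel. ?g x y))"
    using lborel_pair.integrable_fst'[OF HsD(3)[OF u]] by simp
  show i: "integrable lborel (\<lambda>x. (u x - cell_average h u x)\<^sup>2)"
    by (rule Bochner_Integration.integrable_bound[OF i1])
      (use bound in \<open>auto elim!: eventually_mono\<close>)
  have "(LINT x|lborel. (u x - cell_average h u x)\<^sup>2) \<le> (LINT x|lborel. c * (LINT y|lborel. ?g x y))"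
    by (rule integral_mono_AE[OF i i1 bound])
  also have "\<dots> = c * gagliardo s u"
    using lborel_pair.integral_fst'[OF HsD(3)[OF u]] by (simp add: gagliardo_def)
  also have "c = ?N powr p * h powr (2 * s)"
    using h by (simp add: c_def p_def powr_mult powr_add powr_realpow[symmetric])
  finally show "(LINT x|lborel. (u x - cell_average h u x)\<^sup>2)
      \<le> ?N powr (?N + 2 * s) * h powr (2 * s) * gagliardo s u"
    by (simp add: p_def)
qed

section \<open>Compactness of bounded tight sequences\<close>

lemma Hs_tight_sequence_L2_compact:
  fixes u :: "nat \<Rightarrow> 'a::euclidean_space \<Rightarrow> real" and s A B :: real
  assumes s: "0 < s" and u: "\<And>n. u n \<in> Hs s"
    and A: "\<And>n. (l2norm (u n))\<^sup>2 \<le> A" and B: "\<And>n. gagliardo s (u n) \<le> B"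
    and tail: "\<And>e. 0 < e \<Longrightarrow>
      \<exists>R. \<forall>n. (LINT x|lborel. indicator (- cball 0 R) x * (u n x)\<^sup>2) \<le> e"
  obtains r g where "strict_mono (r :: nat \<Rightarrow> nat)" "g \<in> borel_measurable borel"
    "integrable lborel (\<lambda>x. (g x)\<^sup>2)" "AE x in lborel. (\<lambda>n. u (r n) x) \<longlonglongrightarrow> g x"
    "(\<lambda>n. LINT x|lborel. (u (r n) x - g x)\<^sup>2) \<longlonglongrightarrow> 0"
proof -
  note um [measurable] = HsD(1)[OF u]
  note sq = HsD(2)[OF u]
  define H where "H j = 1 / real (Suc j)" for j
  have H: "0 < H j" "H j \<le> 1" for j by (auto simp: H_def)
  \<comment> \<open>All cells of all widths \<open>H j\<close> together are still countable, so a
    single diagonal subsequence works at every scale.\<close>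
  define T where "T = (\<Union>j. range (grid_cell (H j) :: 'a \<Rightarrow> 'a set))"
  have "countable T" unfolding T_def by (intro countable_UN countable_grid_cells) auto
  \<comment> \<open>Cells of width at most 1 have measure at most 1, so the bound is uniform in the
    cell as well as in \<open>n\<close>.\<close>
  have bound: "\<bar>LINT x|lborel. indicator (grid_cell (H j) y) x * u n x\<bar> \<le> 1 + A" for j y n
  proof -
    have "\<bar>LINT x|lborel. indicator (grid_cell (H j) y) x * u n x\<bar> \<le>
        measure lborel (grid_cell (H j) y) + (LINT x|lborel. (u n x)\<^sup>2)"
      using H[of j] by (intro integrable_indicator_mult(2) sq) (auto simp: emeasure_grid_cell)
    also have "measure lborel (grid_cell (H j) y) \<le> 1"
      using H[of j] by (simp add: measure_def emeasure_grid_cell power_le_one)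
    finally show ?thesis using A[of n] by (simp add: l2norm_power2)
  qed
  obtain k where k: "strict_mono (k :: nat \<Rightarrow> nat)"
    "\<And>C. C \<in> T \<Longrightarrow> \<exists>l. (\<lambda>n. LINT x|lborel. indicator C x * u (k n) x) \<longlonglongrightarrow> l"
    by (rule function_convergent_subsequence[OF \<open>countable T\<close>,
          of "\<lambda>n C. LINT x|lborel. indicator C x * u n x" "1 + A"])
      (use bound in \<open>auto simp: T_def\<close>)
  define w where "w n = u (k n)" for n
  have w: "w n \<in> Hs s" "gagliardo s (w n) \<le> B" for n
    by (auto simp: w_def u B)
  have wm [measurable]: "w n \<in> borel_measurable borel" and wsq: "integrable lborel (\<lambda>x. (w n x)\<^sup>2)" for n
    using HsD[OF w(1)] by auto
  have Cauchy: "\<exists>N. \<forall>m\<ge>N. \<forall>n\<ge>N. (LINT x|lborel. (w m x - w n x)\<^sup>2) < e" if e: "0 < e" for e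
  proof -
    \<comment> \<open>The final splitting has coefficients 2, 2, 2, 4 and 4. With each integral at
      most \<open>e / 16\<close> the total stays below \<open>e\<close>.\<close>
    obtain R where R: "\<And>n. (LINT x|lborel. indicator (- cball 0 R) x * (w n x)\<^sup>2) \<le> e / 16"
      using tail[of "e / 16"] e by (auto simp: w_def)
    define K where "K = DIM('a) powr (DIM('a) + 2 * s)"
    have "(\<lambda>j. H j powr (2 * s)) \<longlonglongrightarrow> 0 powr (2 * s)"
      unfolding H_def using s
      by (intro tendsto_powr'[OF LIMSEQ_Suc[OF lim_1_over_n] tendsto_const]) auto
    then have "(\<lambda>j. K * H j powr (2 * s) * (4 * B)) \<longlonglongrightarrow> K * 0 powr (2 * s) * (4 * B)"
      by (intro tendsto_mult_left tendsto_mult_right)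
    then have "eventually (\<lambda>j. K * H j powr (2 * s) * (4 * B) < e / 16) sequentially"
      using e by (intro order_tendstoD(2)) auto
    then obtain j where j: "K * H j powr (2 * s) * (4 * B) < e / 16"
      by (auto simp: eventually_sequentially)
    define h where "h = H j"
    have h: "0 < h" by (simp add: h_def H)
    define a where "a n = cell_average h (w n)" for n
    define c where "c = (1 + A) / h ^ DIM('a)"
    have am [measurable]: "a n \<in> borel_measurable borel" for n
      unfolding a_def by measurable
    have ab: "\<bar>a n x\<bar> \<le> c" for n x
      using bound[of j x "k n"] h unfolding a_def c_def cell_average_def w_def h_def[symmetric]
      by (simp add: divide_right_mono)
    have "convergent (\<lambda>n. a n x)" for x
    proof -
      have "grid_cell h x \<in> T" by (auto simp: T_def h_def)
      from k(2)[OF this] obtain l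
        where "(\<lambda>n. LINT y|lborel. indicator (grid_cell h x) y * w n y) \<longlonglongrightarrow> l"
        by (auto simp: w_def)
      then have "(\<lambda>n. a n x) \<longlonglongrightarrow> l / h ^ DIM('a)"
        unfolding a_def cell_average_def using h by (intro tendsto_intros) auto
      then show ?thesis by (rule convergentI)
    qed
    then obtain L where L: "\<And>x. (\<lambda>n. a n x) \<longlonglongrightarrow> L x"
      unfolding convergent_def by metis
    have Lm [measurable]: "L \<in> borel_measurable borel"
      by (rule borel_measurable_LIMSEQ_real[OF L]) measurable
    have Lb: "\<bar>L x\<bar> \<le> c" for x
      by (rule LIMSEQ_le_const2[OF tendsto_rabs[OF L]]) (use ab in auto)
    let ?I = "indicator (cball 0 R) :: 'a \<Rightarrow> real" and ?J = "indicator (- cball 0 R) :: 'a \<Rightarrow> real"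
    have dom: "(a n x - L x)\<^sup>2 \<le> (2 * c)\<^sup>2" for n x
      using ab[of n x] Lb[of x] by (intro abs_le_square_iff[THEN iffD1]) linarith
    \<comment> \<open>At fixed width the averages are uniformly bounded and the ball has finite
      measure, so a constant dominates there.\<close>
    have iI: "integrable lborel (\<lambda>x. (2 * c)\<^sup>2 * ?I x)"
      using emeasure_lborel_cball_finite[of "0::'a" R] by simp
    have ia: "integrable lborel (\<lambda>x. ?I x * (a n x - L x)\<^sup>2)" for n
      using dom[of n] by (intro Bochner_Integration.integrable_bound[OF iI]) (auto simp: indicator_def)
    have "(\<lambda>n. LINT x|lborel. ?I x * (a n x - L x)\<^sup>2) \<longlonglongrightarrow> (LINT x::'a|lborel. 0)"
    proof (rule integral_dominated_convergence[OF _ _ iI])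
      have "(\<lambda>n. ?I x * (a n x - L x)\<^sup>2) \<longlonglongrightarrow> ?I x * (L x - L x)\<^sup>2" for x
        by (intro tendsto_intros L)
      then show "AE x in lborel. (\<lambda>n. ?I x * (a n x - L x)\<^sup>2) \<longlonglongrightarrow> 0" by simp
    qed (use dom in \<open>auto simp: indicator_def\<close>)
    then have "eventually (\<lambda>n. (LINT x|lborel. ?I x * (a n x - L x)\<^sup>2) < e / 16) sequentially"
      using e by (intro order_tendstoD(2)) auto
    then obtain N where N: "\<And>n. N \<le> n \<Longrightarrow> (LINT x|lborel. ?I x * (a n x - L x)\<^sup>2) < e / 16"
      by (auto simp: eventually_sequentially)
    have "(LINT x|lborel. (w m x - w n x)\<^sup>2) < e" if mn: "N \<le> m" "N \<le> n" for m n
    proof -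
      define v where "v = (\<lambda>x. w m x - w n x)"
      have v: "v \<in> Hs s" "gagliardo s v \<le> 4 * B"
        using Hs_diff[OF w(1)[of m] w(1)[of n]] w(2)[of m] w(2)[of n] by (auto simp: v_def)
      note close = cell_average_L2_close[OF v(1) h s, folded K_def]
      have av: "cell_average h v x = a m x - a n x" for x
        unfolding v_def a_def by (rule cell_average_diff[OF h wm wsq wm wsq])
      have iJ: "integrable lborel (\<lambda>x. ?J x * (w n x)\<^sup>2)" for n
        by (rule Bochner_Integration.integrable_bound[OF wsq[of n]]) (auto simp: indicator_def)
      \<comment> \<open>Inside the ball, \<open>v\<close> is compared with its cell average, and
        that average with zero through the common limit \<open>L\<close>. Outside, only the two
        tails enter.\<close>
      have "(v x)\<^sup>2 \<le> 2 * (?J x * (w m x)\<^sup>2) + 2 * (?J x * (w n x)\<^sup>2)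
          + 2 * (v x - cell_average h v x)\<^sup>2
          + 4 * (?I x * (a m x - L x)\<^sup>2) + 4 * (?I x * (a n x - L x)\<^sup>2)" for x
      proof (cases "x \<in> cball 0 R")
        case True
        have "(v x)\<^sup>2 \<le> 2 * (v x - cell_average h v x)\<^sup>2 + 2 * (cell_average h v x)\<^sup>2"
          using diff_power2_le[of "v x - cell_average h v x" "- cell_average h v x"] by simp
        moreover have "(cell_average h v x)\<^sup>2 \<le> 2 * (a m x - L x)\<^sup>2 + 2 * (a n x - L x)\<^sup>2"
          using diff_power2_le[of "a m x - L x" "a n x - L x"] by (simp add: av)
        ultimately have "(v x)\<^sup>2 \<le> 2 * (v x - cell_average h v x)\<^sup>2
            + 4 * (a m x - L x)\<^sup>2 + 4 * (a n x - L x)\<^sup>2" by linarith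
        then show ?thesis using True by (simp add: indicator_def)
      next
        case False
        then show ?thesis
          using diff_power2_le[of "w m x" "w n x", folded fun_cong[OF v_def, of x]]
          by (simp add: indicator_def add_increasing2)
      qed
      then have "(LINT x|lborel. (v x)\<^sup>2) \<le> (LINT x|lborel.
          2 * (?J x * (w m x)\<^sup>2) + 2 * (?J x * (w n x)\<^sup>2)
          + 2 * (v x - cell_average h v x)\<^sup>2
          + 4 * (?I x * (a m x - L x)\<^sup>2) + 4 * (?I x * (a n x - L x)\<^sup>2))"
        using iJ ia close(1) by (intro integral_mono HsD(2)[OF v(1)]) auto
      also have "\<dots> = 2 * (LINT x|lborel. ?J x * (w m x)\<^sup>2) + 2 * (LINT x|lborel. ?J x * (w n x)\<^sup>2)
          + 2 * (LINT x|lborel. (v x - cell_average h v x)\<^sup>2)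
          + 4 * (LINT x|lborel. ?I x * (a m x - L x)\<^sup>2) + 4 * (LINT x|lborel. ?I x * (a n x - L x)\<^sup>2)"
        using iJ ia close(1) by simp
      also have "(LINT x|lborel. (v x - cell_average h v x)\<^sup>2) < e / 16"
      proof -
        have "K * h powr (2 * s) * gagliardo s v \<le> K * h powr (2 * s) * (4 * B)"
          using v(2) by (intro mult_left_mono) (auto simp: K_def)
        then show ?thesis using close(2) j by (simp add: h_def)
      qed
      finally show ?thesis
        using R[of m] R[of n] N[OF mn(1)] N[OF mn(2)] e unfolding v_def by linarith
    qed
    then show ?thesis by blast
  qed
  obtain q g where q: "strict_mono (q :: nat \<Rightarrow> nat)" "g \<in> borel_measurable lborel"
    "integrable lborel (\<lambda>x. (g x)\<^sup>2)" "AE x in lborel. (\<lambda>n. w (q n) x) \<longlonglongrightarrow> g x"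
    "(\<lambda>n. LINT x|lborel. (w (q n) x - g x)\<^sup>2) \<longlonglongrightarrow> 0"
    by (rule L2_Cauchy_convergent[of w lborel]) (use wsq Cauchy in auto)
  show thesis
    by (rule that[of "k \<circ> q" g]) (use q k(1) in \<open>auto simp: w_def strict_mono_o\<close>)
qed

subsection \<open>Existence of minimizers\<close>

text \<open>Convexity of the power at \<open>x + y = t * (x / t) + (1 - t) * (y / (1 - t))\<close>.
  The free weight matters: as \<open>t\<close> tends to 1, the coefficient of
  \<open>x powr p\<close> tends to 1.\<close>

lemma powr_add_le_weighted:
  fixes x y :: real
  assumes "1 \<le> p" "0 \<le> x" "0 \<le> y" "0 < t" "t < 1"
  shows "(x + y) powr p \<le> t powr (1 - p) * x powr p + (1 - t) powr (1 - p) * y powr p"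
proof -
  have ge1: "1 \<le> r powr (1 - p)" if "0 < r" "r < 1" for r
    using that assms(1) powr_mono'[of "1 - p" 0 r] by simp
  consider "x = 0" | "y = 0" | "0 < x" "0 < y" using assms by linarith
  then show ?thesis
  proof cases
    case 3
    have "((1 - t) *\<^sub>R (y / (1 - t)) + t *\<^sub>R (x / t)) powr p
        \<le> (1 - t) * (y / (1 - t)) powr p + t * (x / t) powr p"
      using assms 3 by (intro convex_onD[OF powr_convex[of p]]) auto
    moreover have "(1 - t) *\<^sub>R (y / (1 - t)) + t *\<^sub>R (x / t) = x + y"
      using assms by simp
    ultimately show ?thesis
      using assms 3 by (simp add: powr_divide powr_diff add.commute)
  qed (use assms ge1[of t] ge1[of "1 - t"] in \<open>auto simp: mult_le_cancel_right1\<close>)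
qed

text \<open>No mass is lost under strong convergence with weight \<open>W\<close>. For fixed
  \<open>t\<close>, letting \<open>n\<close> tend to infinity removes the difference term; then
  \<open>t\<close> tends to 1 from the left.\<close>

lemma integral_powr_limit_le:
  fixes f :: "nat \<Rightarrow> 'a \<Rightarrow> real" and W g :: "'a \<Rightarrow> real"
  assumes p: "1 \<le> p" and W: "\<And>x. 0 \<le> W x"
    and f: "\<And>n. integrable M (\<lambda>x. W x * \<bar>f n x\<bar> powr p)"
    and g: "integrable M (\<lambda>x. W x * \<bar>g x\<bar> powr p)"
    and d: "\<And>n. integrable M (\<lambda>x. W x * \<bar>f n x - g x\<bar> powr p)"
    and d0: "(\<lambda>n. LINT x|M. W x * \<bar>f n x - g x\<bar> powr p) \<longlonglongrightarrow> 0"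
    and fl: "(\<lambda>n. LINT x|M. W x * \<bar>f n x\<bar> powr p) \<longlonglongrightarrow> l"
  shows "l \<le> (LINT x|M. W x * \<bar>g x\<bar> powr p)"
proof -
  let ?G = "LINT x|M. W x * \<bar>g x\<bar> powr p"
  have le: "l \<le> t powr (1 - p) * ?G" if t: "0 < t" "t < 1" for t
  proof -
    have "(LINT x|M. W x * \<bar>f n x\<bar> powr p) \<le>
        t powr (1 - p) * ?G + (1 - t) powr (1 - p) * (LINT x|M. W x * \<bar>f n x - g x\<bar> powr p)" for n
    proof -
      have "(LINT x|M. W x * \<bar>f n x\<bar> powr p) \<le> (LINT x|M. t powr (1 - p) * (W x * \<bar>g x\<bar> powr p)
          + (1 - t) powr (1 - p) * (W x * \<bar>f n x - g x\<bar> powr p))"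
      proof (intro integral_mono f Bochner_Integration.integrable_add integrable_mult_right g d)
        fix x
        have "\<bar>f n x\<bar> powr p \<le> (\<bar>g x\<bar> + \<bar>f n x - g x\<bar>) powr p"
          using p by (intro powr_mono2) auto
        also have "\<dots> \<le> t powr (1 - p) * \<bar>g x\<bar> powr p + (1 - t) powr (1 - p) * \<bar>f n x - g x\<bar> powr p"
          using p t by (intro powr_add_le_weighted) auto
        finally have "W x * \<bar>f n x\<bar> powr p \<le>
            W x * (t powr (1 - p) * \<bar>g x\<bar> powr p + (1 - t) powr (1 - p) * \<bar>f n x - g x\<bar> powr p)"
          by (rule mult_left_mono[OF _ W])
        then show "W x * \<bar>f n x\<bar> powr p \<le> t powr (1 - p) * (W x * \<bar>g x\<bar> powr p)
          + (1 - t) powr (1 - p) * (W x * \<bar>f n x - g x\<bar> powr p)"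
          by (simp add: algebra_simps)
      qed
      then show ?thesis using g d by simp
    qed
    then have "l \<le> t powr (1 - p) * ?G + (1 - t) powr (1 - p) * 0"
      by (intro LIMSEQ_le[OF fl tendsto_add[OF tendsto_const tendsto_mult[OF tendsto_const d0]]]) auto
    then show ?thesis by simp
  qed
  have "((\<lambda>t. t powr (1 - p) * ?G) \<longlongrightarrow> 1 powr (1 - p) * ?G) (at_left 1)"
    by (intro tendsto_intros) auto
  moreover have "eventually (\<lambda>t. l \<le> t powr (1 - p) * ?G) (at_left 1)"
    using eventually_at_left_real[of 0 1] by (rule eventually_mono) (use le in auto)
  ultimately show ?thesis
    by (intro tendsto_lowerbound[where F = "at_left (1::real)"]) auto
qed

text \<open>On functions of unit mass, Gagliardo--Nirenberg lets the fraction \<open>a / A\<close>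
  of the kinetic energy absorb the nonlinear term.\<close>

lemma energy_lower_bound:
  fixes V u :: "'a::euclidean_space \<Rightarrow> real"
  assumes gn: "gn_inequality TYPE('a) s b \<beta> A" and A: "0 < A" and a: "0 \<le> a"
    and u: "u \<in> admissible s V"
  shows "(1 - a / A) * frac_energy s u + (LINT x|lborel. V x * (u x)\<^sup>2) \<le> energy s b \<beta> V a u"
proof -
  have uH: "u \<in> Hs s" and "(l2norm u)\<^sup>2 = 1"
    using u by (auto simp: admissible_def energy_space_def)
  then have "l2norm u = 1"
    using l2norm_nonneg[of u] by (simp add: power2_eq_1_iff)
  then have "A / (1 + \<beta>\<^sup>2) * nl_integral b \<beta> u \<le> frac_energy s u"
    using gn uH by (force simp: gn_inequality_def)
  then have "a / A * (A / (1 + \<beta>\<^sup>2) * nl_integral b \<beta> u) \<le> a / A * frac_energy s u"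
    using a A by (intro mult_left_mono) auto
  then have "a / (1 + \<beta>\<^sup>2) * nl_integral b \<beta> u \<le> a / A * frac_energy s u"
    using A by simp
  then show ?thesis
    by (simp add: energy_def algebra_simps)
qed

lemma frac_energy_nonneg:
  fixes u :: "'a::euclidean_space \<Rightarrow> real"
  assumes "0 < frac_const TYPE('a) s"
  shows "0 \<le> frac_energy s u"
  using assms by (simp add: frac_energy_gagliardo gagliardo_nonneg)

text \<open>Strictness comes from the kinetic term: were it zero, Gagliardo--Nirenberg would force
  the nonlinear integral, and with it the mass, to vanish.\<close>

lemma energy_pos:
  fixes V u :: "'a::euclidean_space \<Rightarrow> real"
  assumes gn: "gn_inequality TYPE('a) s b \<beta> A" and a: "0 < a" "a < A"
    and c: "0 < frac_const TYPE('a) s" and V: "AE x in lborel. 0 \<le> V x"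
    and u: "u \<in> admissible s V"
  shows "0 < energy s b \<beta> V a u"
proof -
  have A: "0 < A" using a by simp
  have uH: "u \<in> Hs s" and n: "(l2norm u)\<^sup>2 = 1"
    using u by (auto simp: admissible_def energy_space_def)
  have Vn: "0 \<le> (LINT x|lborel. V x * (u x)\<^sup>2)"
    by (intro integral_nonneg_AE) (use V in \<open>auto elim: eventually_mono\<close>)
  have "frac_energy s u \<noteq> 0"
  proof
    assume 0: "frac_energy s u = 0"
    have int: "integrable lborel (nl_integrand b \<beta> u)"
      and "A / (1 + \<beta>\<^sup>2) * nl_integral b \<beta> u \<le> 0"
      using gn uH 0 by (force simp: gn_inequality_def)+
    moreover have "0 < A / (1 + \<beta>\<^sup>2)" using A by (intro divide_pos_pos) (auto simp: add_pos_nonneg)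
    ultimately have "nl_integral b \<beta> u \<le> 0" by (simp only: mult_le_0_iff) linarith
    moreover have "0 \<le> nl_integral b \<beta> u"
      unfolding nl_integral_def by (simp add: nl_integrand_nonneg)
    ultimately have "nl_integral b \<beta> u = 0" by linarith
    then have "AE x in lborel. nl_integrand b \<beta> u x = 0"
      using integral_nonneg_eq_0_iff_AE[OF int] by (simp add: nl_integral_def nl_integrand_nonneg)
    \<comment> \<open>The weight is nonzero away from the origin; at the origin its formal value can
      be 0 and gives no information on \<open>u\<close>.\<close>
    moreover have "AE x in lborel. x \<noteq> (0::'a)"
      by (rule AE_lborel_singleton)
    ultimately have "AE x in lborel. (u x)\<^sup>2 = 0"
      by eventually_elim (simp add: nl_integrand_def)
    then have "(l2norm u)\<^sup>2 = 0"
      unfolding l2norm_power2 by (rule integral_eq_zero_AE)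
    then show False using n by simp
  qed
  then have "0 < (1 - a / A) * frac_energy s u"
    using frac_energy_nonneg[OF c, of u] a A by (intro mult_pos_pos) auto
  then show ?thesis
    using energy_lower_bound[OF gn A less_imp_le[OF a(1)] u] Vn by linarith
qed

text \<open>The energies stay bounded while the norms tend to zero, and
  \<open>\<beta> \<noteq> 0\<close> makes the exponent of the norm positive.\<close>

lemma gn_norm_tendsto_0:
  fixes v :: "nat \<Rightarrow> 'a::euclidean_space \<Rightarrow> real"
  assumes gn: "gn_inequality TYPE('a) s b \<beta> A" and A: "0 < A" and \<beta>: "\<beta> \<noteq> 0"
    and c: "0 < frac_const TYPE('a) s"
    and v: "\<And>n. v n \<in> Hs s" and B: "\<And>n. gagliardo s (v n) \<le> B"
    and 0: "(\<lambda>n. LINT x|lborel. (v n x)\<^sup>2) \<longlonglongrightarrow> 0"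
  shows "(\<lambda>n. nl_integral b \<beta> (v n)) \<longlonglongrightarrow> 0"
proof -
  define C where "C = (1 + \<beta>\<^sup>2) / A * (frac_const TYPE('a) s / 2 * B)"
  have "(\<lambda>n. l2norm (v n)) \<longlonglongrightarrow> sqrt 0"
    unfolding l2norm_def power2_abs by (rule tendsto_real_sqrt[OF 0])
  then have "(\<lambda>n. l2norm (v n) powr (2 * \<beta>\<^sup>2)) \<longlonglongrightarrow> 0 powr (2 * \<beta>\<^sup>2)"
    using \<beta> by (intro tendsto_powr'[OF _ tendsto_const]) (auto simp: l2norm_nonneg)
  then have lim: "(\<lambda>n. C * l2norm (v n) powr (2 * \<beta>\<^sup>2)) \<longlonglongrightarrow> 0"
    by (auto intro: tendsto_mult_right_zero)
  have le: "nl_integral b \<beta> (v n) \<le> C * l2norm (v n) powr (2 * \<beta>\<^sup>2)" for n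
  proof -
    have p: "0 < 1 + \<beta>\<^sup>2" by (simp add: add_pos_nonneg)
    have "A / (1 + \<beta>\<^sup>2) * nl_integral b \<beta> (v n) \<le> frac_energy s (v n) * l2norm (v n) powr (2 * \<beta>\<^sup>2)"
      using gn v[of n] by (auto simp: gn_inequality_def)
    also have "\<dots> \<le> frac_const TYPE('a) s / 2 * B * l2norm (v n) powr (2 * \<beta>\<^sup>2)"
      unfolding frac_energy_gagliardo using c B[of n] by (intro mult_right_mono mult_left_mono) auto
    finally show ?thesis
      using A p by (simp add: C_def field_simps)
  qed
  show ?thesis
    by (rule tendsto_sandwich[OF _ _ tendsto_const lim])
      (use le in \<open>auto simp: nl_integral_def nl_integrand_nonneg\<close>)
qed

text \<open>The direct method. Nonemptiness of the admissible set is assumed here and supplied later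
  by the regime in which the infimum is minus infinity.\<close>

lemma minimizer_exists:
  fixes V :: "'a::euclidean_space \<Rightarrow> real"
  assumes s: "0 < s" and \<beta>: "\<beta> \<noteq> 0"
    and gn: "gn_inequality TYPE('a) s b \<beta> A" and a: "0 < a" "a < A"
    and c: "0 < frac_const TYPE('a) s"
    and Vm [measurable]: "V \<in> borel_measurable borel" and V: "AE x in lborel. 0 \<le> V x"
    and V_lim: "filterlim V at_top at_infinity"
    and ne: "admissible s V \<noteq> {}"
  obtains u where "u \<in> admissible s V" "min_energy s b \<beta> V a = ereal (energy s b \<beta> V a u)"
proof -
  have A: "0 < A" using a by simp
  let ?E = "energy s b \<beta> V a" and ?c = "frac_const TYPE('a) s / 2"
  define \<kappa> where "\<kappa> = a / (1 + \<beta>\<^sup>2)"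
  have \<kappa>: "0 < \<kappa>" unfolding \<kappa>_def using a by (intro divide_pos_pos) (auto simp: add_pos_nonneg)
  let ?P = "\<lambda>u. LINT x|lborel. V x * (u x)\<^sup>2"
  have E: "?E u = ?c * gagliardo s u + ?P u - \<kappa> * nl_integral b \<beta> u" for u
    by (simp add: energy_def frac_energy_gagliardo \<kappa>_def)
  have Pn: "0 \<le> ?P u" for u
    by (intro integral_nonneg_AE) (use V in \<open>auto elim: eventually_mono\<close>)
  have adm: "u \<in> Hs s" "integrable lborel (\<lambda>x. V x * (u x)\<^sup>2)" "(l2norm u)\<^sup>2 = 1"
    if "u \<in> admissible s V" for u
    using that by (auto simp: admissible_def energy_space_def)
  \<comment> \<open>Positivity of the energies permits a real infimum; the extended-real one is
    recovered at the end.\<close>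
  define e where "e = Inf (?E ` admissible s V)"
  have bdd: "bdd_below (?E ` admissible s V)"
    using energy_pos[OF gn a c V] by (intro bdd_belowI[of _ 0]) (auto simp: less_imp_le)
  have e_le: "e \<le> ?E u" if "u \<in> admissible s V" for u
    unfolding e_def using that bdd by (intro cInf_lower) auto
  have e0: "0 \<le> e"
    unfolding e_def using ne energy_pos[OF gn a c V] by (intro cInf_greatest) (auto simp: less_imp_le)
  have "\<exists>u\<in>admissible s V. ?E u < e + 1 / real (Suc n)" for n
    using cInf_lessD[of "?E ` admissible s V" "e + 1 / real (Suc n)"] ne by (auto simp: e_def)
  then obtain u where u: "\<And>n. u n \<in> admissible s V" and uE: "\<And>n. ?E (u n) < e + 1 / real (Suc n)"
    by metis
  note uH = adm(1)[OF u] and uP = adm(2)[OF u] and un = adm(3)[OF u]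
  have Elim: "(\<lambda>n. ?E (u n)) \<longlonglongrightarrow> e"
  proof (rule tendsto_sandwich[OF _ _ tendsto_const])
    show "(\<lambda>n. e + 1 / real (Suc n)) \<longlonglongrightarrow> e"
      using tendsto_add[OF tendsto_const LIMSEQ_Suc[OF lim_1_over_n], of e] by simp
  qed (intro always_eventually allI less_imp_le[OF uE] e_le u)+
  have uE1: "?E (u n) \<le> e + 1" for n
  proof -
    have "1 / real (Suc n) \<le> 1" by simp
    then show ?thesis using uE[of n] by linarith
  qed
  have F0: "0 \<le> (1 - a / A) * frac_energy s (u n)" for n
    using frac_energy_nonneg[OF c, of "u n"] a A by (intro mult_nonneg_nonneg) auto
  have PB: "?P (u n) \<le> e + 1" for n
    using energy_lower_bound[OF gn A less_imp_le[OF a(1)] u[of n]] uE1[of n] F0[of n] by linarith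
  define B where "B = (e + 1) / ((1 - a / A) * ?c)"
  have GB: "gagliardo s (u n) \<le> B" for n
  proof -
    have "0 < (1 - a / A) * ?c" using a A c by (intro mult_pos_pos) auto
    moreover have "(1 - a / A) * ?c * gagliardo s (u n) \<le> e + 1"
      using energy_lower_bound[OF gn A less_imp_le[OF a(1)] u[of n]] uE1[of n] Pn[of "u n"]
      unfolding frac_energy_gagliardo mult.assoc[symmetric] by linarith
    ultimately show ?thesis
      unfolding B_def by (simp only: pos_le_divide_eq) (simp only: mult.commute)
  qed
  have tail: "\<exists>R. \<forall>n. (LINT x|lborel. indicator (- cball 0 R) x * (u n x)\<^sup>2) \<le> d" if d: "0 < d" for d
  proof -
    \<comment> \<open>Potential energies are at most \<open>e + 1\<close>, so where \<open>V\<close>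
      is at least \<open>l\<close> the mass is at most \<open>(e + 1) / l = d\<close>.\<close>
    define l where "l = (e + 1) / d"
    have l: "0 < l" using d e0 by (simp add: l_def)
    have "eventually (\<lambda>x. l \<le> V x) at_infinity"
      using V_lim by (simp add: filterlim_at_top)
    then obtain R where R: "\<And>x. R \<le> norm x \<Longrightarrow> l \<le> V x"
      by (auto simp: eventually_at_infinity)
    have "(LINT x|lborel. indicator (- cball 0 R) x * (u n x)\<^sup>2) \<le> d" for n
    proof -
      have "(LINT x|lborel. indicator (- cball 0 R) x * (u n x)\<^sup>2) \<le> (LINT x|lborel. 1 / l * (V x * (u n x)\<^sup>2))"
      proof (rule integral_mono_AE)
        show "integrable lborel (\<lambda>x. indicator (- cball 0 R) x * (u n x)\<^sup>2)"
          using HsD(1)[OF uH[of n]]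
          by (intro Bochner_Integration.integrable_bound[OF HsD(2)[OF uH[of n]]])
            (auto simp: indicator_def)
        show "AE x in lborel. indicator (- cball 0 R) x * (u n x)\<^sup>2 \<le> 1 / l * (V x * (u n x)\<^sup>2)"
          using V
        proof eventually_elim
          case (elim x)
          show ?case
          proof (cases "x \<in> cball 0 R")
            case False
            then have "l * (u n x)\<^sup>2 \<le> V x * (u n x)\<^sup>2"
              using R[of x] by (intro mult_right_mono) auto
            then show ?thesis using False l by (simp add: field_simps)
          qed (use elim l in auto)
        qed
      qed (use uP in simp)
      also have "\<dots> = ?P (u n) / l" by simp
      also have "\<dots> \<le> (e + 1) / l" using PB l by (intro divide_right_mono) auto
      also have "\<dots> = d" using d e0 by (simp add: l_def)
      finally show ?thesis .
    qed
    then show ?thesis by blast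
  qed
  obtain r g where r: "strict_mono (r :: nat \<Rightarrow> nat)" and gm [measurable]: "g \<in> borel_measurable borel"
    and g2: "integrable lborel (\<lambda>x. (g x)\<^sup>2)"
    and ae: "AE x in lborel. (\<lambda>n. u (r n) x) \<longlonglongrightarrow> g x"
    and L2: "(\<lambda>n. LINT x|lborel. (u (r n) x - g x)\<^sup>2) \<longlonglongrightarrow> 0"
    by (rule Hs_tight_sequence_L2_compact[OF s uH _ GB tail, of 1]) (use un in auto)
  \<comment> \<open>A further subsequence makes kinetic and potential energy converge separately.
    Since the total energy converges, the nonlinear term then converges too.\<close>
  have "bounded (range (\<lambda>n. (gagliardo s (u (r n)), ?P (u (r n)))))"
  proof (rule bounded_subset)
    show "bounded ({0..B} \<times> {0..e + 1})" by (intro bounded_Times bounded_closed_interval)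
  qed (use gagliardo_nonneg GB Pn PB in auto)
  then obtain l q where q: "strict_mono (q :: nat \<Rightarrow> nat)"
    and lq: "((\<lambda>n. (gagliardo s (u (r n)), ?P (u (r n)))) \<circ> q) \<longlonglongrightarrow> l"
    using bounded_imp_convergent_subsequence by blast
  define w where "w n = u (r (q n))" for n
  have w: "w n \<in> Hs s" "integrable lborel (\<lambda>x. V x * (w n x)\<^sup>2)" "(LINT x|lborel. (w n x)\<^sup>2) = 1"
    "gagliardo s (w n) \<le> B" for n
    using uH uP un GB by (auto simp: w_def l2norm_power2)
  note wm [measurable] = HsD(1)[OF w(1)]
  have wg: "(\<lambda>n. gagliardo s (w n)) \<longlonglongrightarrow> fst l" and wP: "(\<lambda>n. ?P (w n)) \<longlonglongrightarrow> snd l"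
    using tendsto_fst[OF lq] tendsto_snd[OF lq] by (simp_all add: w_def o_def)
  have wae: "AE x in lborel. (\<lambda>n. w n x) \<longlonglongrightarrow> g x"
    using ae by eventually_elim (auto simp: w_def dest: LIMSEQ_subseq_LIMSEQ[OF _ q] simp: o_def)
  have wL2: "(\<lambda>n. LINT x|lborel. (w n x - g x)\<^sup>2) \<longlonglongrightarrow> 0"
    using LIMSEQ_subseq_LIMSEQ[OF L2 q] by (simp add: w_def o_def)
  have wE: "(\<lambda>n. ?E (w n)) \<longlonglongrightarrow> e"
    using LIMSEQ_subseq_LIMSEQ[OF Elim strict_mono_o[OF r q]] by (simp add: w_def o_def)
  have gae: "AE z in lborel \<Otimes>\<^sub>M lborel.
      (\<lambda>n. gagliardo_integrand s (w n) (w n) z) \<longlonglongrightarrow> gagliardo_integrand s g g z"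
    using AE_pair_fst[OF wae sigma_finite_lborel] AE_pair_snd[OF wae sigma_finite_lborel]
    by eventually_elim (unfold gagliardo_integrand_diag divide_inverse, intro tendsto_intros)
  have G: "integrable (lborel \<Otimes>\<^sub>M lborel) (gagliardo_integrand s g g)" "gagliardo s g \<le> fst l"
    unfolding gagliardo_def
    by (rule fatou_integral_tendsto[OF HsD(3)[OF w(1)] _ _ gae wg[unfolded gagliardo_def]];
        simp add: gagliardo_integrand_nonneg)+
  have gH: "g \<in> Hs s" by (intro HsI gm g2 G)
  have Vae: "AE x in lborel. (\<lambda>n. V x * (w n x)\<^sup>2) \<longlonglongrightarrow> V x * (g x)\<^sup>2"
    using wae by eventually_elim (intro tendsto_intros)
  have P: "integrable lborel (\<lambda>x. V x * (g x)\<^sup>2)" "?P g \<le> snd l"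
    by (rule fatou_integral_tendsto[OF w(2) _ _ Vae wP];
        (use V in \<open>auto elim: eventually_mono\<close>))+
  have "(LINT x|lborel. (g x)\<^sup>2) \<le> 1"
  proof (rule fatou_integral_tendsto(2)[OF HsD(2)[OF w(1)]])
    show "AE x in lborel. (\<lambda>n. (w n x)\<^sup>2) \<longlonglongrightarrow> (g x)\<^sup>2"
      using wae by eventually_elim (intro tendsto_intros)
  qed (use w(3) in auto)
  \<comment> \<open>Fatou gives only the upper bound on the mass. Strong convergence, used with
    exponent 2 and weight 1, excludes a loss.\<close>
  moreover have "1 \<le> (LINT x|lborel. (g x)\<^sup>2)"
    using integral_powr_limit_le[of 2 "\<lambda>_. 1" lborel w g 1] HsD(2)[OF w(1)] g2 w(3) wL2
      integrable_diff_power2[OF _ _ HsD(2)[OF w(1)] g2]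
    by simp
  ultimately have gadm: "g \<in> admissible s V"
    using gH P by (simp add: admissible_def energy_space_def l2norm_power2)
  have nlint: "integrable lborel (nl_integrand b \<beta> v)" if "v \<in> Hs s" for v :: "'a \<Rightarrow> real"
    using gn that by (simp add: gn_inequality_def)
  have d: "(\<lambda>x. w n x - g x) \<in> Hs s" "gagliardo s (\<lambda>x. w n x - g x) \<le> 2 * B + 2 * gagliardo s g" for n
    using Hs_diff[OF w(1)[of n] gH] w(4)[of n] by auto
  have d0: "(\<lambda>n. nl_integral b \<beta> (\<lambda>x. w n x - g x)) \<longlonglongrightarrow> 0"
    by (rule gn_norm_tendsto_0[OF gn A \<beta> c d wL2])
  have "(\<lambda>n. (?c * gagliardo s (w n) + ?P (w n) - ?E (w n)) / \<kappa>) \<longlonglongrightarrow> (?c * fst l + snd l - e) / \<kappa>"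
    using \<kappa> by (intro tendsto_intros wg wP wE) auto
  then have "(\<lambda>n. nl_integral b \<beta> (w n)) \<longlonglongrightarrow> (?c * fst l + snd l - e) / \<kappa>"
    using \<kappa> unfolding E by simp
  \<comment> \<open>The nonlinear term enters the energy with a minus sign, so its limit must be
    bounded above by its value at \<open>g\<close>; Fatou's lemma points the other way.\<close>
  then have "(?c * fst l + snd l - e) / \<kappa> \<le> nl_integral b \<beta> g"
    using nlint[OF w(1)] nlint[OF gH] nlint[OF d(1)] d0
    unfolding nl_integral_def nl_integrand_def
    by (intro integral_powr_limit_le[of "2 + 2 * \<beta>\<^sup>2" "\<lambda>x. norm x powr (- b)"]) (auto simp: nl_integrand_def[abs_def])
  then have "?c * fst l + snd l - e \<le> \<kappa> * nl_integral b \<beta> g"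
    using \<kappa> by (simp only: pos_divide_le_eq) (simp only: mult.commute)
  moreover have "?c * gagliardo s g \<le> ?c * fst l"
    using c G(2) by (intro mult_left_mono) auto
  ultimately have Eg: "?E g \<le> e"
    unfolding E using P(2) by linarith
  show thesis
  proof (rule that[OF gadm antisym])
    show "min_energy s b \<beta> V a \<le> ereal (?E g)"
      unfolding min_energy_def by (rule INF_lower[OF gadm])
    show "ereal (?E g) \<le> min_energy s b \<beta> V a"
      unfolding min_energy_def using Eg e_le by (intro INF_greatest) force
  qed
qed

theorem theorem1p1:
  fixes s b \<beta> astar :: real
    and Q V :: "'a::euclidean_space \<Rightarrow> real"
  assumes s: "1 / 2 < s" "s < 1"
    and N: "real DIM('a) > 2 * s"
    and b: "0 < b" "b < min (real DIM('a) / 2) 1"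
    and \<beta>: "\<beta> = sqrt ((2 * s - b) / real DIM('a))"
    and Q: "gn_optimizer s b \<beta> Q"
    and astar: "astar = l2norm Q powr (2 * \<beta>\<^sup>2)"
    and V_nonneg: "AE x in lborel. 0 \<le> V x"
    and V_loc: "V \<in> Linf_loc"
    and V_lim: "filterlim V at_top at_infinity"
  shows "(\<forall>a. 0 < a \<and> a < astar \<longrightarrow> (\<exists>u. is_minimizer s b \<beta> V a u))
       \<and> (\<forall>a. a > astar \<longrightarrow> \<not> (\<exists>u. is_minimizer s b \<beta> V a u))
       \<and> (\<forall>a. 0 < a \<and> a < astar \<longrightarrow> min_energy s b \<beta> V a > 0)
       \<and> (\<forall>a. a > astar \<longrightarrow> min_energy s b \<beta> V a = -\<infinity>)"
proof -
  have s0: "0 < s" using s by simp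
  have q: "0 < (2 * s - b) / real DIM('a)" using s b by simp
  then have \<beta>0: "\<beta> \<noteq> 0" and \<beta>2: "real DIM('a) * \<beta>\<^sup>2 = 2 * s - b"
    using \<beta> by auto
  have QH: "Q \<in> Hs s" and Qpos: "AE x in lborel. 0 < Q x"
    and gn: "gn_inequality TYPE('a) s b \<beta> astar"
    and opt: "astar / (1 + \<beta>\<^sup>2) * nl_integral b \<beta> Q = frac_energy s Q * l2norm Q powr (2 * \<beta>\<^sup>2)"
    and Qe: "frac_energy s Q = 1 / \<beta>\<^sup>2 * (LINT x|lborel. \<bar>Q x\<bar>\<^sup>2)"
    and Qnl: "frac_energy s Q = 1 / (1 + \<beta>\<^sup>2) * nl_integral b \<beta> Q"
    using Q by (auto simp: gn_optimizer_def astar)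
  have lQ: "0 < l2norm Q"
  proof (rule ccontr)
    assume "\<not> 0 < l2norm Q"
    then have "l2norm Q = 0" using l2norm_nonneg[of Q] by simp
    then have "AE x in lborel. Q x = 0"
      by (rule AE_eq_0_if_l2norm_eq_0[OF HsD(2)[OF QH]])
    \<comment> \<open>\<open>Q\<close> would be both zero and positive almost everywhere, although
      Lebesgue measure is not the zero measure.\<close>
    then have "AE x in (lborel :: 'a measure). False"
      using Qpos by eventually_elim simp
    then show False by (simp only: eventually_False ae_filter_eq_bot_iff) simp
  qed
  have FQ: "0 < frac_energy s Q"
    using Qe lQ \<beta>0 l2norm_power2[of Q] by (simp add: zero_less_divide_iff) (metis zero_less_power)
  \<comment> \<open>The sign is read off from the positive kinetic energy of \<open>Q\<close>, so
    the defining integral need not be evaluated.\<close>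
  have c: "0 < frac_const TYPE('a) s"
    using FQ gagliardo_nonneg[of s Q] by (auto simp: frac_energy_gagliardo zero_less_mult_iff)
  have Vm: "V \<in> borel_measurable borel" using V_loc by (simp add: Linf_loc_def)
  have above: "min_energy s b \<beta> V a = - \<infinity>" if "astar < a" for a
  proof (rule min_energy_minus_infinity_if_gn_violated[OF s0 s(2) \<beta>2 \<beta>0 V_loc QH])
    show "integrable lborel (nl_integrand b \<beta> Q)"
      using gn QH by (simp add: gn_inequality_def)
    \<comment> \<open>\<open>Q\<close> attains equality with constant \<open>astar\<close>, and its
      kinetic energy equals \<open>nl_integral b \<beta> Q / (1 + \<beta>\<^sup>2)\<close>, so any
      larger constant violates the inequality strictly.\<close>
    have "astar * frac_energy s Q < a * frac_energy s Q"
      using that FQ by (rule mult_strict_right_mono)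
    then show "frac_energy s Q * l2norm Q powr (2 * \<beta>\<^sup>2) < a / (1 + \<beta>\<^sup>2) * nl_integral b \<beta> Q"
      unfolding opt[symmetric] using Qnl by simp
  qed
  \<comment> \<open>An infimum over the empty set would be plus infinity, contradicting the value
    found at \<open>astar + 1\<close>.\<close>
  have ne: "admissible s V \<noteq> {}"
    using above[of "astar + 1"] by (auto simp: min_energy_def)
  have below: "\<exists>u. is_minimizer s b \<beta> V a u" "0 < min_energy s b \<beta> V a" if a: "0 < a" "a < astar" for a
  proof -
    obtain u where "u \<in> admissible s V" "min_energy s b \<beta> V a = ereal (energy s b \<beta> V a u)"
      by (rule minimizer_exists[OF s0 \<beta>0 gn a c Vm V_nonneg V_lim ne])
    then show "\<exists>u. is_minimizer s b \<beta> V a u" "0 < min_energy s b \<beta> V a"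
      using energy_pos[OF gn a c V_nonneg] by (auto simp: is_minimizer_def zero_ereal_def)
  qed
  show ?thesis
    \<comment> \<open>Above the threshold nothing attains the infimum, because every energy is a
      real number.\<close>
    using below above by (auto simp: is_minimizer_def)
qed

end
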